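(* Let $(\mathbf{L},M_C)$ be an implicit optimal control system where, in a coordinate chart $(t,q^i,u^a,v^i)$ of $C\times_E J^1\pi$, $M_C$ is given by $\Psi^\alpha(t,q,v,u)=0$, $1\le\alpha\le s$, with $d\Psi^1\wedge\dots\wedge d\Psi^s\neq0$, and the cost function is $\mathbb{L}=\mathbb{L}(t,q,u)$. Let $Z\in\mathfrak{X}(\mathcal{W}_0^{M_C})$ satisfy $$ i(Z)\Omega_{\mathcal{W}_0^{M_C}}=0,\qquad i(Z)\,dt=1 . $$ Then for every integral curve $t\mapsto (t,q^i(t),u^a(t),v^i(t),p(t),p_i(t))$ of $Z$ one has $v^i(t)=\dot q^i(t)$, and there exist functions $\lambda_\alpha(t)$, $1\le\alpha\le s$, such that $$ \frac{d}{dt}\left(\lambda_\alpha(t)\frac{\partial\Psi^\alpha}{\partial v^i}(t,q(t),\dot q(t),u(t))\right)+\frac{\partial\mathbb{L}}{\partial q^i}(t,q(t),u(t))-\lambda_\alpha(t)\frac{\partial\Psi^\alpha}{\partial q^i}(t,q(t),\dot q(t),u(t))=0, $$ $$ \frac{\partial\mathbb{L}}{\partial u^a}(t,q(t),u(t))-\lambda_\alpha(t)\frac{\partial\Psi^\alpha}{\partial u^a}(t,q(t),\dot q(t),u(t))=0, $$ $$ \Psi^\alpha(t,q(t),\dot q(t),u(t))=0, $$ for all $1\le i\le n$, $1\le a\le m$ and $1\le\alpha\le s$.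
   Context: Manifolds are real, second countable and $C^\infty$; maps are $C^\infty$; repeated indices are summed. $\pi\colon E\to\mathbb{R}$ is a fiber bundle with $\dim E=n+1$ and adapted local coordinates $(t,q^i)$, $1\le i\le n$, where $t$ is the global coordinate of $\mathbb{R}$; $dt$ also denotes its pullbacks. $\pi^C\colon C\to E$ is a fiber bundle (the bundle of controls) with coordinates $(t,q^i,u^a)$, $1\le a\le m$. $J^1\pi\to E$ is the first jet bundle of $\pi$, with coordinates $(t,q^i,v^i)$. $M_C\subset C\times_E J^1\pi$ is a submanifold whose projection to $E$ is a surjective submersion. An implicit optimal control system is a pair $(\mathbf{L},M_C)$ with $\mathbf{L}=\mathbb{L}\,dt$, $\mathbb{L}$ a smooth cost function. $\mathcal{W}^{M_C}=M_C\times_E T^*E$ is a submanifold of $C\times_E J^1\pi\times_E T^*E$, which has coordinates $(t,q^i,u^a,v^i,p,p_i)$, where $p\,dt+p_i\,dq^i$ is the general covector in $T^*E$. $\mathcal{W}_0^{M_C}\subset\mathcal{W}^{M_C}$ is the submanifold given by $p+p_iv^i-\mathbb{L}=0$ (here $p+p_iv^i$ is the globally defined value of the covector $\alpha=p\,dt+p_idq^i$ on $T\phi(\partial/\partial t)$, for any local section $\phi$ of $\pi$ representing the jet with coordinates $(t,q^i,v^i)$). $\Omega_{\mathcal{W}_0^{M_C}}$ is the pullback to $\mathcal{W}_0^{M_C}$ (by inclusion and projection to $T^*E$) of the canonical 2-form $dq^i\wedge dp_i+dt\wedge dp$ of $T^*E$. *)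

theory Defs
  imports "HOL-Analysis.Analysis"
begin

section \<open>Smooth maps between Euclidean spaces\<close>

primrec Ck_on :: "nat \<Rightarrow> 'a::real_normed_vector set \<Rightarrow> ('a \<Rightarrow> 'b::real_normed_vector) \<Rightarrow> bool" where
  "Ck_on 0 S f \<longleftrightarrow> continuous_on S f"
| "Ck_on (Suc k) S f \<longleftrightarrow>
     (\<forall>x\<in>S. f differentiable (at x)) \<and> (\<forall>w. Ck_on k S (\<lambda>x. frechet_derivative f (at x) w))"

text \<open>Only used for open sets \<open>S\<close> of finite-dimensional spaces.\<close>
definition smooth_on :: "'a::real_normed_vector set \<Rightarrow> ('a \<Rightarrow> 'b::real_normed_vector) \<Rightarrow> bool" where
  "smooth_on S f \<longleftrightarrow> (\<forall>k. Ck_on k S f)"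

text \<open>The derivative of \<open>f\<close> at \<open>z\<close> in the direction \<open>b\<close>; for a coordinate vector \<open>b\<close> this is a
  partial derivative.\<close>
definition partial :: "('a::real_normed_vector \<Rightarrow> real) \<Rightarrow> 'a \<Rightarrow> 'a \<Rightarrow> real" where
  "partial f b z = deriv (\<lambda>r. f (z + r *\<^sub>R b)) 0"

text \<open>The exterior product of finitely many covectors, as an alternating multilinear map.\<close>
definition wedge :: "('s::finite \<Rightarrow> 'a \<Rightarrow> real) \<Rightarrow> ('s \<Rightarrow> 'a) \<Rightarrow> real" where
  "wedge \<omega> X = det (\<chi> \<alpha> \<beta>. \<omega> \<alpha> (X \<beta>))"


section \<open>Smooth manifolds\<close>

text \<open>A chart is a domain together with a coordinate map, whose values outside the domain are
  irrelevant. A manifold is given by an atlas; its points are the points covered by the charts, and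
  its topology is the one induced by the charts.\<close>

type_synonym ('a, 'b) chart = "'a set \<times> ('a \<Rightarrow> 'b)"

definition chart_inv :: "('a, 'b) chart \<Rightarrow> 'b \<Rightarrow> 'a" where
  "chart_inv \<kappa> = inv_into (fst \<kappa>) (snd \<kappa>)"

definition transition :: "('a, 'b) chart \<Rightarrow> ('a, 'b) chart \<Rightarrow> 'b \<Rightarrow> 'b" where
  "transition \<kappa> \<kappa>' = snd \<kappa>' \<circ> chart_inv \<kappa>"

definition carrier :: "('a, 'b) chart set \<Rightarrow> 'a set" where
  "carrier A = (\<Union>\<kappa>\<in>A. fst \<kappa>)"

definition charts_at :: "('a, 'b) chart set \<Rightarrow> 'a \<Rightarrow> ('a, 'b) chart set" where
  "charts_at A x = {\<kappa>\<in>A. x \<in> fst \<kappa>}"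

definition smooth_atlas :: "('a, 'b::euclidean_space) chart set \<Rightarrow> bool" where
  "smooth_atlas A \<longleftrightarrow>
     (\<forall>\<kappa>\<in>A. inj_on (snd \<kappa>) (fst \<kappa>) \<and> open (snd \<kappa> ` fst \<kappa>)) \<and>
     (\<forall>\<kappa>\<in>A. \<forall>\<kappa>'\<in>A. open (snd \<kappa> ` (fst \<kappa> \<inter> fst \<kappa>')) \<and>
        smooth_on (snd \<kappa> ` (fst \<kappa> \<inter> fst \<kappa>')) (transition \<kappa> \<kappa>'))"

definition manifold_topology :: "('a, 'b::euclidean_space) chart set \<Rightarrow> 'a topology" where
  "manifold_topology A =
     topology (\<lambda>U. U \<subseteq> carrier A \<and> (\<forall>\<kappa>\<in>A. open (snd \<kappa> ` (U \<inter> fst \<kappa>))))"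

definition smooth_manifold :: "('a, 'b::euclidean_space) chart set \<Rightarrow> bool" where
  "smooth_manifold A \<longleftrightarrow>
     smooth_atlas A \<and> Hausdorff_space (manifold_topology A) \<and> second_countable (manifold_topology A)"

definition compatible_chart :: "('a, 'b::euclidean_space) chart set \<Rightarrow> ('a, 'b) chart \<Rightarrow> bool" where
  "compatible_chart A \<kappa> \<longleftrightarrow> fst \<kappa> \<subseteq> carrier A \<and> smooth_atlas (insert \<kappa> A)"

definition maximal_atlas :: "('a, 'b::euclidean_space) chart set \<Rightarrow> bool" where
  "maximal_atlas A \<longleftrightarrow> (\<forall>\<kappa>. compatible_chart A \<kappa> \<longrightarrow> \<kappa> \<in> A)"

definition real_line :: "(real, real) chart set" where
  "real_line = {(UNIV, \<lambda>t. t)}"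

definition restrict_atlas :: "('a, 'b) chart set \<Rightarrow> 'a set \<Rightarrow> ('a, 'b) chart set" where
  "restrict_atlas A S = (\<lambda>\<kappa>. (fst \<kappa> \<inter> S, snd \<kappa>)) ` A"

definition product_atlas :: "('a, 'b) chart set \<Rightarrow> ('c, 'd) chart set \<Rightarrow> ('a \<times> 'c, 'b \<times> 'd) chart set" where
  "product_atlas A B = {(fst \<kappa> \<times> fst \<mu>, map_prod (snd \<kappa>) (snd \<mu>)) | \<kappa> \<mu>. \<kappa> \<in> A \<and> \<mu> \<in> B}"

definition smooth_at ::
  "('a, 'b::euclidean_space) chart set \<Rightarrow> ('c, 'd::euclidean_space) chart set \<Rightarrow> ('a \<Rightarrow> 'c) \<Rightarrow> 'a \<Rightarrow> bool"
where
  "smooth_at A B f x \<longleftrightarrow>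
     (\<exists>\<kappa>\<in>charts_at A x. \<exists>\<mu>\<in>charts_at B (f x). \<exists>N. open N \<and> snd \<kappa> x \<in> N \<and> N \<subseteq> snd \<kappa> ` fst \<kappa> \<and>
        (\<forall>y\<in>N. f (chart_inv \<kappa> y) \<in> fst \<mu>) \<and> smooth_on N (\<lambda>y. snd \<mu> (f (chart_inv \<kappa> y))))"

definition smooth_map ::
  "('a, 'b::euclidean_space) chart set \<Rightarrow> ('c, 'd::euclidean_space) chart set \<Rightarrow> ('a \<Rightarrow> 'c) \<Rightarrow> bool"
where
  "smooth_map A B f \<longleftrightarrow> (\<forall>x\<in>carrier A. smooth_at A B f x)"

definition diffeomorphism ::
  "('a, 'b::euclidean_space) chart set \<Rightarrow> ('c, 'd::euclidean_space) chart set \<Rightarrow> ('a \<Rightarrow> 'c) \<Rightarrow> bool"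
where
  "diffeomorphism A B f \<longleftrightarrow> bij_betw f (carrier A) (carrier B) \<and>
     smooth_map A B f \<and> smooth_map B A (inv_into (carrier A) f)"

text \<open>\<open>fibre_bundle A B F \<pi>\<close>: \<open>\<pi>\<close> is a fibre bundle with total space \<open>A\<close>, base \<open>B\<close> and typical
  fibre \<open>F\<close>.\<close>
definition fibre_bundle ::
  "('a, 'b::euclidean_space) chart set \<Rightarrow> ('c, 'd::euclidean_space) chart set \<Rightarrow>
   ('f, 'g::euclidean_space) chart set \<Rightarrow> ('a \<Rightarrow> 'c) \<Rightarrow> bool"
where
  "fibre_bundle A B F \<pi> \<longleftrightarrow>
     smooth_manifold A \<and> smooth_manifold B \<and> smooth_manifold F \<and>
     smooth_map A B \<pi> \<and> \<pi> ` carrier A = carrier B \<and>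
     (\<forall>b\<in>carrier B. \<exists>U \<Phi>. openin (manifold_topology B) U \<and> b \<in> U \<and>
        diffeomorphism (restrict_atlas A {x\<in>carrier A. \<pi> x \<in> U})
          (product_atlas (restrict_atlas B U) F) \<Phi> \<and>
        (\<forall>x\<in>carrier A. \<pi> x \<in> U \<longrightarrow> fst (\<Phi> x) = \<pi> x))"


section \<open>Tangent vectors, covectors and submanifolds\<close>

text \<open>A tangent vector at \<open>x\<close> is the family of its component vectors in all charts around \<open>x\<close>;
  these are related by the Jacobians of the coordinate changes.\<close>

type_synonym ('a, 'b) tvec = "('a, 'b) chart \<Rightarrow> 'b"

definition tangent_space :: "('a, 'b::euclidean_space) chart set \<Rightarrow> 'a \<Rightarrow> ('a, 'b) tvec set" where
  "tangent_space A x = {X. (\<forall>\<kappa>. \<kappa> \<notin> charts_at A x \<longrightarrow> X \<kappa> = 0) \<and>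
     (\<forall>\<kappa>\<in>charts_at A x. \<forall>\<kappa>'\<in>charts_at A x.
        X \<kappa>' = frechet_derivative (transition \<kappa> \<kappa>') (at (snd \<kappa> x)) (X \<kappa>))}"

text \<open>The tangent vector at \<open>x\<close> with components \<open>w\<close> in the chart \<open>\<kappa>\<close>.\<close>
definition tangent_vec ::
  "('a, 'b::euclidean_space) chart set \<Rightarrow> ('a, 'b) chart \<Rightarrow> 'a \<Rightarrow> 'b \<Rightarrow> ('a, 'b) tvec" where
  "tangent_vec A \<kappa> x w = (\<lambda>\<kappa>'. if \<kappa>' \<in> charts_at A x
     then frechet_derivative (transition \<kappa> \<kappa>') (at (snd \<kappa> x)) w else 0)"

definition velocity ::
  "('a, 'b::euclidean_space) chart set \<Rightarrow> (real \<Rightarrow> 'a) \<Rightarrow> real \<Rightarrow> ('a, 'b) tvec" where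
  "velocity A c t = (\<lambda>\<kappa>. if \<kappa> \<in> charts_at A (c t)
     then vector_derivative (snd \<kappa> \<circ> c) (at t) else 0)"

text \<open>The tangent map; its value on tangent vectors does not depend on the chosen chart.\<close>
definition tangent_map ::
  "('a, 'b::euclidean_space) chart set \<Rightarrow> ('c, 'd::euclidean_space) chart set \<Rightarrow>
   ('a \<Rightarrow> 'c) \<Rightarrow> 'a \<Rightarrow> ('a, 'b) tvec \<Rightarrow> ('c, 'd) tvec"
where
  "tangent_map A B f x X = (let \<kappa> = (SOME \<kappa>. \<kappa> \<in> charts_at A x) in
     (\<lambda>\<mu>. if \<mu> \<in> charts_at B (f x)
        then frechet_derivative (snd \<mu> \<circ> f \<circ> chart_inv \<kappa>) (at (snd \<kappa> x)) (X \<kappa>) else 0))"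

definition differential ::
  "('a, 'b::euclidean_space) chart set \<Rightarrow> ('a \<Rightarrow> real) \<Rightarrow> 'a \<Rightarrow> ('a, 'b) tvec \<Rightarrow> real" where
  "differential A f x X = tangent_map A real_line f x X (UNIV, \<lambda>t. t)"

text \<open>Linear functionals on the tangent space, extended by \<open>0\<close> to the whole type.\<close>
definition cotangent_space ::
  "('a, 'b::euclidean_space) chart set \<Rightarrow> 'a \<Rightarrow> (('a, 'b) tvec \<Rightarrow> real) set" where
  "cotangent_space A x = {\<alpha>. (\<forall>X. X \<notin> tangent_space A x \<longrightarrow> \<alpha> X = 0) \<and>
     (\<forall>X\<in>tangent_space A x. \<forall>Y\<in>tangent_space A x. \<forall>a b.
        \<alpha> (\<lambda>\<kappa>. a *\<^sub>R X \<kappa> + b *\<^sub>R Y \<kappa>) = a * \<alpha> X + b * \<alpha> Y)}"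

definition submanifold :: "('a, 'b::euclidean_space) chart set \<Rightarrow> 'a set \<Rightarrow> bool" where
  "submanifold A S \<longleftrightarrow> S \<subseteq> carrier A \<and>
     (\<exists>k. \<forall>x\<in>S. \<exists>\<kappa>. compatible_chart A \<kappa> \<and> x \<in> fst \<kappa> \<and>
        (\<exists>V. subspace V \<and> dim V = k \<and> snd \<kappa> ` (S \<inter> fst \<kappa>) = snd \<kappa> ` fst \<kappa> \<inter> V))"

definition sub_tangent_space ::
  "('a, 'b::euclidean_space) chart set \<Rightarrow> 'a set \<Rightarrow> 'a \<Rightarrow> ('a, 'b) tvec set" where
  "sub_tangent_space A S x = {velocity A c 0 | c. c 0 = x \<and>
     (\<exists>I. open I \<and> 0 \<in> I \<and> (\<forall>s\<in>I. smooth_at real_line A c s \<and> c s \<in> S))}"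

text \<open>Smoothness on a submanifold \<open>S\<close>, by means of local smooth extensions.\<close>
definition smooth_fun_on ::
  "('a, 'b::euclidean_space) chart set \<Rightarrow> 'a set \<Rightarrow> ('a \<Rightarrow> 'k::real_normed_vector) \<Rightarrow> bool" where
  "smooth_fun_on A S f \<longleftrightarrow> (\<forall>\<kappa>\<in>A. \<forall>x\<in>S \<inter> fst \<kappa>.
     \<exists>N g. open N \<and> snd \<kappa> x \<in> N \<and> N \<subseteq> snd \<kappa> ` fst \<kappa> \<and> smooth_on N g \<and>
       (\<forall>y\<in>S \<inter> fst \<kappa>. snd \<kappa> y \<in> N \<longrightarrow> f y = g (snd \<kappa> y)))"

definition vector_field_on ::
  "('a, 'b::euclidean_space) chart set \<Rightarrow> 'a set \<Rightarrow> ('a \<Rightarrow> ('a, 'b) tvec) \<Rightarrow> bool" where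
  "vector_field_on A S Z \<longleftrightarrow> (\<forall>x\<in>S. Z x \<in> sub_tangent_space A S x) \<and>
     (\<forall>\<kappa>\<in>A. smooth_fun_on A (S \<inter> fst \<kappa>) (\<lambda>x. Z x \<kappa>))"

definition integral_curve ::
  "('a, 'b::euclidean_space) chart set \<Rightarrow> 'a set \<Rightarrow> ('a \<Rightarrow> ('a, 'b) tvec) \<Rightarrow>
   real set \<Rightarrow> (real \<Rightarrow> 'a) \<Rightarrow> bool" where
  "integral_curve A S Z J c \<longleftrightarrow>
     (\<forall>t\<in>J. c t \<in> S \<and> smooth_at real_line A c t \<and> velocity A c t = Z (c t))"


section \<open>The bundles of the control problem\<close>

text \<open>Coordinates are grouped as \<open>(t, q)\<close> on \<open>E\<close>, \<open>((t, q), u)\<close> on \<open>C\<close>, \<open>(((t, q), u), v)\<close> on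
  \<open>C \<times>\<^sub>E J\<^sup>1\<pi>\<close>, \<open>((t, q), (p, p\<^sub>i))\<close> on \<open>T\<^sup>*E\<close>, and \<open>((((t, q), u), v), (p, p\<^sub>i))\<close> on
  \<open>C \<times>\<^sub>E J\<^sup>1\<pi> \<times>\<^sub>E T\<^sup>*E\<close>.\<close>

type_synonym 'n E_coords = "real \<times> (real ^ 'n)"
type_synonym ('n, 'm) C_coords = "'n E_coords \<times> (real ^ 'm)"
type_synonym ('n, 'm) CJ_coords = "('n, 'm) C_coords \<times> (real ^ 'n)"
type_synonym 'n T_coords = "'n E_coords \<times> (real \<times> (real ^ 'n))"
type_synonym ('n, 'm) W_coords = "('n, 'm) CJ_coords \<times> (real \<times> (real ^ 'n))"

definition adapted_charts ::
  "('e, 'n::finite E_coords) chart set \<Rightarrow> ('e \<Rightarrow> real) \<Rightarrow> ('e, 'n E_coords) chart set" where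
  "adapted_charts E \<pi> = {\<kappa>\<in>E. \<forall>x\<in>fst \<kappa>. fst (snd \<kappa> x) = \<pi> x}"

definition adapted_control_charts ::
  "('c, ('n::finite, 'm::finite) C_coords) chart set \<Rightarrow> ('c \<Rightarrow> 'e) \<Rightarrow> ('e, 'n E_coords) chart \<Rightarrow>
   ('c, ('n, 'm) C_coords) chart set" where
  "adapted_control_charts C \<pi>C \<kappa> =
     {\<mu>\<in>C. \<forall>c\<in>fst \<mu>. \<pi>C c \<in> fst \<kappa> \<and> fst (snd \<mu> c) = snd \<kappa> (\<pi>C c)}"

subsection \<open>First jets of sections\<close>

definition local_section ::
  "('e, 'n::finite E_coords) chart set \<Rightarrow> ('e \<Rightarrow> real) \<Rightarrow> real \<Rightarrow> (real \<Rightarrow> 'e) \<Rightarrow> bool" where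
  "local_section E \<pi> t \<phi> \<longleftrightarrow>
     (\<exists>I. open I \<and> t \<in> I \<and> (\<forall>s\<in>I. smooth_at real_line E \<phi> s \<and> \<pi> (\<phi> s) = s))"

text \<open>A jet is a pair of its target \<open>e\<close> and the class of all local sections through \<open>e\<close> with the
  same first-order part at \<open>\<pi> e\<close>.\<close>
type_synonym 'e jet = "'e \<times> (real \<Rightarrow> 'e) set"

definition jet_of ::
  "('e, 'n::finite E_coords) chart set \<Rightarrow> ('e \<Rightarrow> real) \<Rightarrow> real \<Rightarrow> (real \<Rightarrow> 'e) \<Rightarrow> 'e jet" where
  "jet_of E \<pi> t \<phi> = (\<phi> t, {\<psi>. local_section E \<pi> t \<psi> \<and> \<psi> t = \<phi> t \<and> velocity E \<psi> t = velocity E \<phi> t})"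

definition J1 :: "('e, 'n::finite E_coords) chart set \<Rightarrow> ('e \<Rightarrow> real) \<Rightarrow> 'e jet set" where
  "J1 E \<pi> = {jet_of E \<pi> t \<phi> | t \<phi>. local_section E \<pi> t \<phi>}"

text \<open>The vector \<open>T\<phi>(\<partial>/\<partial>t)\<close> for a local section \<open>\<phi>\<close> representing the jet.\<close>
definition jet_velocity ::
  "('e, 'n::finite E_coords) chart set \<Rightarrow> ('e \<Rightarrow> real) \<Rightarrow> 'e jet \<Rightarrow> ('e, 'n E_coords) tvec" where
  "jet_velocity E \<pi> j = velocity E (SOME \<phi>. \<phi> \<in> snd j) (\<pi> (fst j))"

definition CJ ::
  "('e, 'n::finite E_coords) chart set \<Rightarrow> ('e \<Rightarrow> real) \<Rightarrow>
   ('c, ('n, 'm::finite) C_coords) chart set \<Rightarrow> ('c \<Rightarrow> 'e) \<Rightarrow> ('c \<times> 'e jet) set" where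
  "CJ E \<pi> C \<pi>C = {(c, j). c \<in> carrier C \<and> j \<in> J1 E \<pi> \<and> fst j = \<pi>C c}"

definition CJ_chart ::
  "('e, 'n::finite E_coords) chart set \<Rightarrow> ('e \<Rightarrow> real) \<Rightarrow>
   ('c, ('n, 'm::finite) C_coords) chart set \<Rightarrow> ('c \<Rightarrow> 'e) \<Rightarrow>
   ('e, 'n E_coords) chart \<Rightarrow> ('c, ('n, 'm) C_coords) chart \<Rightarrow>
   ('c \<times> 'e jet, ('n, 'm) CJ_coords) chart" where
  "CJ_chart E \<pi> C \<pi>C \<kappa> \<mu> =
     ({(c, j) \<in> CJ E \<pi> C \<pi>C. c \<in> fst \<mu>}, \<lambda>(c, j). (snd \<mu> c, snd (jet_velocity E \<pi> j \<kappa>)))"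

definition CJ_atlas ::
  "('e, 'n::finite E_coords) chart set \<Rightarrow> ('e \<Rightarrow> real) \<Rightarrow>
   ('c, ('n, 'm::finite) C_coords) chart set \<Rightarrow> ('c \<Rightarrow> 'e) \<Rightarrow>
   ('c \<times> 'e jet, ('n, 'm) CJ_coords) chart set" where
  "CJ_atlas E \<pi> C \<pi>C = {CJ_chart E \<pi> C \<pi>C \<kappa> \<mu> | \<kappa> \<mu>.
     \<kappa> \<in> adapted_charts E \<pi> \<and> \<mu> \<in> adapted_control_charts C \<pi>C \<kappa>}"

subsection \<open>The cotangent bundle\<close>

type_synonym ('e, 'n) covector = "'e \<times> (('e, 'n E_coords) tvec \<Rightarrow> real)"

definition cotangent_bundle ::
  "('e, 'n::finite E_coords) chart set \<Rightarrow> ('e, 'n) covector set" where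
  "cotangent_bundle E = {(e, \<alpha>). e \<in> carrier E \<and> \<alpha> \<in> cotangent_space E e}"

text \<open>The components of a covector: its values on \<open>\<partial>/\<partial>t\<close> and \<open>\<partial>/\<partial>q\<^sup>i\<close>.\<close>
definition momenta ::
  "('e, 'n::finite E_coords) chart set \<Rightarrow> ('e, 'n E_coords) chart \<Rightarrow> ('e, 'n) covector \<Rightarrow>
   real \<times> (real ^ 'n)" where
  "momenta E \<kappa> = (\<lambda>(e, \<alpha>).
     (\<alpha> (tangent_vec E \<kappa> e (1, 0)), \<chi> i. \<alpha> (tangent_vec E \<kappa> e (0, axis i 1))))"

definition T_chart ::
  "('e, 'n::finite E_coords) chart set \<Rightarrow> ('e, 'n E_coords) chart \<Rightarrow>
   (('e, 'n) covector, 'n T_coords) chart" where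
  "T_chart E \<kappa> = ({a \<in> cotangent_bundle E. fst a \<in> fst \<kappa>}, \<lambda>a. (snd \<kappa> (fst a), momenta E \<kappa> a))"

definition T_atlas ::
  "('e, 'n::finite E_coords) chart set \<Rightarrow> ('e \<Rightarrow> real) \<Rightarrow> (('e, 'n) covector, 'n T_coords) chart set" where
  "T_atlas E \<pi> = T_chart E ` adapted_charts E \<pi>"

text \<open>The form \<open>dq\<^sup>i \<and> dp\<^sub>i + dt \<and> dp\<close> on component vectors.\<close>
definition canonical_form :: "'n::finite T_coords \<Rightarrow> 'n T_coords \<Rightarrow> real" where
  "canonical_form = (\<lambda>((t, q), (p, r)) ((t', q'), (p', r')).
     (\<Sum>i\<in>UNIV. q $ i * r' $ i - q' $ i * r $ i) + (t * p' - t' * p))"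

subsection \<open>Implicit optimal control systems\<close>

definition control_bundles ::
  "('e, 'n::finite E_coords) chart set \<Rightarrow> ('f, real ^ 'n) chart set \<Rightarrow> ('e \<Rightarrow> real) \<Rightarrow>
   ('c, ('n, 'm::finite) C_coords) chart set \<Rightarrow> ('g, real ^ 'm) chart set \<Rightarrow> ('c \<Rightarrow> 'e) \<Rightarrow> bool" where
  "control_bundles E F \<pi> C G \<pi>C \<longleftrightarrow>
     maximal_atlas E \<and> maximal_atlas C \<and>
     fibre_bundle E real_line F \<pi> \<and> fibre_bundle C E G \<pi>C"

text \<open>The pair \<open>(\<bbbL> dt, M)\<close>; the cost function \<open>\<bbbL>\<close> is a smooth function on \<open>M\<close>.\<close>
definition implicit_optimal_control_system ::
  "('e, 'n::finite E_coords) chart set \<Rightarrow> ('e \<Rightarrow> real) \<Rightarrow>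
   ('c, ('n, 'm::finite) C_coords) chart set \<Rightarrow> ('c \<Rightarrow> 'e) \<Rightarrow>
   ('c \<times> 'e jet \<Rightarrow> real) \<Rightarrow> ('c \<times> 'e jet) set \<Rightarrow> bool" where
  "implicit_optimal_control_system E \<pi> C \<pi>C L M \<longleftrightarrow>
     submanifold (CJ_atlas E \<pi> C \<pi>C) M \<and>
     (\<lambda>x. \<pi>C (fst x)) ` M = carrier E \<and>
     (\<forall>x\<in>M. tangent_map (CJ_atlas E \<pi> C \<pi>C) E (\<lambda>x. \<pi>C (fst x)) x `
        sub_tangent_space (CJ_atlas E \<pi> C \<pi>C) M x = tangent_space E (\<pi>C (fst x))) \<and>
     smooth_fun_on (CJ_atlas E \<pi> C \<pi>C) M L"

text \<open>The points of \<open>C \<times>\<^sub>E J\<^sup>1\<pi> \<times>\<^sub>E T\<^sup>*E\<close> are written \<open>(x, a)\<close> with \<open>x \<in> C \<times>\<^sub>E J\<^sup>1\<pi>\<close> and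
  \<open>a \<in> T\<^sup>*E\<close> over the same point of \<open>E\<close>.\<close>
type_synonym ('e, 'c, 'n) W_point = "('c \<times> 'e jet) \<times> ('e, 'n) covector"

definition W_chart ::
  "('e, 'n::finite E_coords) chart set \<Rightarrow> ('e \<Rightarrow> real) \<Rightarrow>
   ('c, ('n, 'm::finite) C_coords) chart set \<Rightarrow> ('c \<Rightarrow> 'e) \<Rightarrow>
   ('e, 'n E_coords) chart \<Rightarrow> ('c, ('n, 'm) C_coords) chart \<Rightarrow>
   (('e, 'c, 'n) W_point, ('n, 'm) W_coords) chart" where
  "W_chart E \<pi> C \<pi>C \<kappa> \<mu> =
     ({(x, a). x \<in> fst (CJ_chart E \<pi> C \<pi>C \<kappa> \<mu>) \<and> a \<in> cotangent_bundle E \<and> fst a = \<pi>C (fst x)},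
      \<lambda>(x, a). (snd (CJ_chart E \<pi> C \<pi>C \<kappa> \<mu>) x, momenta E \<kappa> a))"

definition W_atlas ::
  "('e, 'n::finite E_coords) chart set \<Rightarrow> ('e \<Rightarrow> real) \<Rightarrow>
   ('c, ('n, 'm::finite) C_coords) chart set \<Rightarrow> ('c \<Rightarrow> 'e) \<Rightarrow>
   (('e, 'c, 'n) W_point, ('n, 'm) W_coords) chart set" where
  "W_atlas E \<pi> C \<pi>C = {W_chart E \<pi> C \<pi>C \<kappa> \<mu> | \<kappa> \<mu>.
     \<kappa> \<in> adapted_charts E \<pi> \<and> \<mu> \<in> adapted_control_charts C \<pi>C \<kappa>}"

text \<open>\<open>WM\<close> is \<open>M \<times>\<^sub>E T\<^sup>*E\<close>, and \<open>W0\<close> is its subset \<open>p + p\<^sub>i v\<^sup>i - \<bbbL> = 0\<close>.\<close>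

definition WM ::
  "('e, 'n::finite E_coords) chart set \<Rightarrow> ('c \<Rightarrow> 'e) \<Rightarrow> ('c \<times> 'e jet) set \<Rightarrow> ('e, 'c, 'n) W_point set"
where
  "WM E \<pi>C M = {(x, a). x \<in> M \<and> a \<in> cotangent_bundle E \<and> fst a = \<pi>C (fst x)}"

definition W0 ::
  "('e, 'n::finite E_coords) chart set \<Rightarrow> ('e \<Rightarrow> real) \<Rightarrow> ('c \<Rightarrow> 'e) \<Rightarrow>
   ('c \<times> 'e jet \<Rightarrow> real) \<Rightarrow> ('c \<times> 'e jet) set \<Rightarrow> ('e, 'c, 'n) W_point set"
where
  "W0 E \<pi> \<pi>C L M =
     {(x, a) \<in> WM E \<pi>C M. snd a (jet_velocity E \<pi> (snd x)) - L x = 0}"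

text \<open>The condition \<open>i(Z)\<Omega> = 0\<close>, where \<open>\<Omega>\<close> is the pullback to \<open>W0\<close> of the canonical 2-form of
  \<open>T\<^sup>*E\<close>. The canonical 2-form has the expression \<open>dq\<^sup>i \<and> dp\<^sub>i + dt \<and> dp\<close> in each natural chart
  of \<open>T\<^sup>*E\<close>, so it vanishes on two tangent vectors if and only if this expression does, in one or
  equivalently in every natural chart.\<close>
definition contraction_vanishes ::
  "('e, 'n::finite E_coords) chart set \<Rightarrow> ('e \<Rightarrow> real) \<Rightarrow>
   ('c, ('n, 'm::finite) C_coords) chart set \<Rightarrow> ('c \<Rightarrow> 'e) \<Rightarrow>
   ('c \<times> 'e jet \<Rightarrow> real) \<Rightarrow> ('c \<times> 'e jet) set \<Rightarrow>
   (('e, 'c, 'n) W_point \<Rightarrow> (('e, 'c, 'n) W_point, ('n, 'm) W_coords) tvec) \<Rightarrow> bool" where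
  "contraction_vanishes E \<pi> C \<pi>C L M Z \<longleftrightarrow>
     (\<forall>w\<in>W0 E \<pi> \<pi>C L M.
      \<forall>Y\<in>sub_tangent_space (W_atlas E \<pi> C \<pi>C) (W0 E \<pi> \<pi>C L M) w.
      \<forall>\<kappa>\<in>charts_at (T_atlas E \<pi>) (snd w).
        canonical_form
          (tangent_map (W_atlas E \<pi> C \<pi>C) (T_atlas E \<pi>) snd w (Z w) \<kappa>)
          (tangent_map (W_atlas E \<pi> C \<pi>C) (T_atlas E \<pi>) snd w Y \<kappa>) = 0)"

end

(* In a chart, a tangent vector of W0 is a pair (h, r') with h in the kernel of the differentials of
   the constraints; its p-component is then determined by the equation of W0. Pairing the curve's
   velocity with the vectors (0, r') gives v = dq/dt. Pairing it with the vectors (h, 0) shows that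
   the covector dL - p_i dv^i - (dp_i/dt) dq^i - (dp/dt) dt vanishes on that kernel, hence is a
   combination of the dPsi^alpha; its coefficients are the multipliers. The v-components say that
   lambda_alpha dPsi^alpha/dv^i = -p_i along the curve, so this sum is differentiable although no
   regularity of the multipliers themselves is established.

   The tangent vectors have to be realised by smooth curves in W0. The inverse function theorem only
   yields a differentiable curve in the zero set of Psi; a slice chart of the submanifold M then
   replaces it by a smooth one with the same velocity. *)

theory Submission
  imports Defs
begin

section \<open>Calculus of smooth maps\<close>

text \<open>The canonical form sees only the (t, q, p, p_i) components of a vector, so the du/dt and
  dv/dt components of the curve drop out of every pairing. Conversely M constrains only (t, q, u,
  v): in the chart, W0 is the graph of p = L - p_i v^i over the product of the zero set of the Psi
  with the space of all p_i. This product shape is what allows h and r' to be varied independently.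

  A second obstacle is that a tangent vector is a family indexed by charts, and
  \<open>tangent_map\<close> evaluates it in an arbitrarily chosen one. A computation in the given
  chart is therefore justified only once all transitions between the charts of the ambient space of
  W0 are smooth. For the coordinates (t, q, u, v) this is read off from a slice chart of M; the
  momenta transform linearly by a Jacobian of the base, which is smooth as well.\<close>

lemma frechet_derivative_cong_open:
  assumes "open S" "x \<in> S" "\<And>y. y \<in> S \<Longrightarrow> f y = g y"
  shows "frechet_derivative f (at x) = frechet_derivative g (at x)"
    and "f differentiable (at x) \<longleftrightarrow> g differentiable (at x)"
proof -
  have "(f has_derivative D) (at x) \<longleftrightarrow> (g has_derivative D) (at x)" for D
    using assms by (metis has_derivative_transform_within_open)
  then show "frechet_derivative f (at x) = frechet_derivative g (at x)"
    and "f differentiable (at x) \<longleftrightarrow> g differentiable (at x)"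
    by (simp_all add: frechet_derivative_def differentiable_def)
qed

section \<open>Closure properties of maps of finite differentiability order\<close>

lemma Ck_on_cong:
  assumes "open S" "\<And>x. x \<in> S \<Longrightarrow> f x = g x"
  shows "Ck_on k S f \<longleftrightarrow> Ck_on k S g"
  using assms(2)
proof (induction k arbitrary: f g)
  case 0
  then show ?case by (simp cong: continuous_on_cong)
next
  case (Suc k)
  have "Ck_on k S (\<lambda>x. frechet_derivative f (at x) w) \<longleftrightarrow>
        Ck_on k S (\<lambda>x. frechet_derivative g (at x) w)" for w
    by (intro Suc.IH) (simp add: frechet_derivative_cong_open(1)[OF assms(1) _ Suc.prems])
  moreover have "(\<forall>x\<in>S. f differentiable (at x)) \<longleftrightarrow> (\<forall>x\<in>S. g differentiable (at x))"
    by (intro ball_cong refl frechet_derivative_cong_open(2)[OF assms(1) _ Suc.prems]) simp_all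
  ultimately show ?case by simp
qed

lemma Ck_on_subset: "Ck_on k S f \<Longrightarrow> T \<subseteq> S \<Longrightarrow> Ck_on k T f"
  by (induction k arbitrary: f) (auto intro: continuous_on_subset)

lemma Ck_on_Suc_imp: "Ck_on (Suc k) S f \<Longrightarrow> Ck_on k S f"
proof (induction k arbitrary: f)
  case 0
  then show ?case
    by (auto intro!: differentiable_imp_continuous_on simp: differentiable_on_def differentiable_at_withinI)
next
  case (Suc k)
  then show ?case by (metis Ck_on.simps(2))
qed

text \<open>\<open>frechet_derivative\<close> is a chosen value, awkward to compute with.
  Derivatives at a point are unique, so the choice agrees on \<open>S\<close> with any explicit
  derivative \<open>f'\<close>, and \<open>Ck_on_cong\<close> transfers the order of smoothness.
  Each rule of differentiation below enters in this way.\<close>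

lemma Ck_on_SucI:
  assumes "open S" "\<And>x. x \<in> S \<Longrightarrow> (f has_derivative f' x) (at x)" "\<And>w. Ck_on k S (\<lambda>x. f' x w)"
  shows "Ck_on (Suc k) S f"
proof -
  have "Ck_on k S (\<lambda>x. frechet_derivative f (at x) w) \<longleftrightarrow> Ck_on k S (\<lambda>x. f' x w)" for w
    using assms(2) by (intro Ck_on_cong[OF assms(1)]) (metis frechet_derivative_at)
  with assms(2,3) show ?thesis by (auto simp: differentiable_def)
qed

lemma Ck_on_Suc_has_derivative:
  "Ck_on (Suc k) S f \<Longrightarrow> x \<in> S \<Longrightarrow> (f has_derivative frechet_derivative f (at x)) (at x)"
  by (auto simp: frechet_derivative_works[symmetric])

lemma Ck_on_const: "open S \<Longrightarrow> Ck_on k S (\<lambda>x. c)"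
  by (induction k arbitrary: c) (auto simp: frechet_derivative_const)

lemma Ck_on_bounded_linear:
  assumes "bounded_linear h" "open S" "Ck_on k S f"
  shows "Ck_on k S (\<lambda>x. h (f x))"
  using assms(3)
proof (induction k arbitrary: f)
  case 0
  then show ?case using bounded_linear.continuous_on[OF assms(1)] by simp
next
  case (Suc k)
  show ?case
  proof (rule Ck_on_SucI[OF assms(2)])
    show "((\<lambda>x. h (f x)) has_derivative (\<lambda>w. h (frechet_derivative f (at x) w))) (at x)" if "x \<in> S" for x
      by (rule bounded_linear.has_derivative[OF assms(1) Ck_on_Suc_has_derivative[OF Suc.prems that]])
    show "Ck_on k S (\<lambda>x. h (frechet_derivative f (at x) w))" for w
      using Suc by simp
  qed
qed

lemma Ck_on_linear: "bounded_linear h \<Longrightarrow> open S \<Longrightarrow> Ck_on k S h"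
  by (cases k)
    (auto intro: linear_continuous_on Ck_on_const bounded_linear_imp_has_derivative
      simp del: Ck_on.simps(2) intro!: Ck_on_SucI[where f'="\<lambda>_. h"])

lemma Ck_on_add:
  assumes "open S" "Ck_on k S f" "Ck_on k S g"
  shows "Ck_on k S (\<lambda>x. f x + g x)"
  using assms(2,3)
proof (induction k arbitrary: f g)
  case 0
  then show ?case by (auto intro: continuous_intros)
next
  case (Suc k)
  show ?case
  proof (rule Ck_on_SucI[OF assms(1)])
    show "((\<lambda>x. f x + g x) has_derivative
        (\<lambda>w. frechet_derivative f (at x) w + frechet_derivative g (at x) w)) (at x)" if "x \<in> S" for x
      using Suc.prems that by (intro has_derivative_add Ck_on_Suc_has_derivative)
    show "Ck_on k S (\<lambda>x. frechet_derivative f (at x) w + frechet_derivative g (at x) w)" for w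
      using Suc by simp
  qed
qed

lemma Ck_on_sum:
  assumes "open S" "\<And>i. i \<in> I \<Longrightarrow> Ck_on k S (f i)"
  shows "Ck_on k S (\<lambda>x. \<Sum>i\<in>I. f i x)"
  using assms(2)
  by (induction I rule: infinite_finite_induct) (auto intro: Ck_on_const Ck_on_add assms(1))

lemma Ck_on_Pair:
  assumes "open S" "Ck_on k S f" "Ck_on k S g"
  shows "Ck_on k S (\<lambda>x. (f x, g x))"
proof -
  have "Ck_on k S (\<lambda>x. (f x, 0) + (0, g x))"
    by (intro Ck_on_add assms Ck_on_bounded_linear[where h="\<lambda>y. (y, 0)"]
      Ck_on_bounded_linear[where h="\<lambda>y. (0, y)"] bounded_linear_Pair bounded_linear_ident bounded_linear_zero)
  then show ?thesis by simp
qed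

text \<open>The product rule gives two mixed terms, each pairing an undifferentiated factor with a
  derivative. The induction hypothesis wants both at order \<open>k\<close>, so the undifferentiated
  factor, known at order \<open>Suc k\<close>, is lowered with \<open>Ck_on_Suc_imp\<close>.\<close>

lemma Ck_on_bilinear:
  assumes "bounded_bilinear p" "open S" "Ck_on k S f" "Ck_on k S g"
  shows "Ck_on k S (\<lambda>x. p (f x) (g x))"
  using assms(3,4)
proof (induction k arbitrary: f g)
  case 0
  then show ?case using bounded_bilinear.continuous_on[OF assms(1)] by simp
next
  case (Suc k)
  show ?case
  proof (rule Ck_on_SucI[OF assms(2)])
    show "((\<lambda>x. p (f x) (g x)) has_derivative
        (\<lambda>w. p (f x) (frechet_derivative g (at x) w) + p (frechet_derivative f (at x) w) (g x))) (at x)"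
      if "x \<in> S" for x
      using Suc.prems that by (intro bounded_bilinear.FDERIV[OF assms(1)] Ck_on_Suc_has_derivative)
    show "Ck_on k S (\<lambda>x. p (f x) (frechet_derivative g (at x) w) +
        p (frechet_derivative f (at x) w) (g x))" for w
      using Suc.prems Ck_on_Suc_imp[OF Suc.prems(1)] Ck_on_Suc_imp[OF Suc.prems(2)]
      by (intro Ck_on_add[OF assms(2)] Suc.IH) simp_all
  qed
qed

text \<open>\<open>Ck_on\<close> controls a derivative only in fixed directions, while the chain
  rule applies the derivative of \<open>g\<close> to a direction that moves with \<open>x\<close>.
  Expanding this direction in \<open>Basis\<close> leaves a finite sum of scalar coefficients times
  derivatives of \<open>g\<close> in fixed directions, which the bilinear rule and the induction
  hypothesis handle. Hence the Euclidean middle space.\<close>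

lemma Ck_on_compose:
  fixes f :: "'a::real_normed_vector \<Rightarrow> 'b::euclidean_space"
    and g :: "'b \<Rightarrow> 'c::real_normed_vector"
  assumes "open S" "f ` S \<subseteq> T" "Ck_on k S f" "Ck_on k T g"
  shows "Ck_on k S (\<lambda>x. g (f x))"
  using assms(3,4)
proof (induction k arbitrary: g)
  case 0
  then show ?case using assms(2) by (auto intro: continuous_on_compose2)
next
  case (Suc k)
  have fT: "f x \<in> T" if "x \<in> S" for x using assms(2) that by auto
  show ?case
  proof (rule Ck_on_SucI[OF assms(1)])
    fix x assume "x \<in> S"
    let ?G = "frechet_derivative g (at (f x))" and ?F = "frechet_derivative f (at x)"
    have G: "(g has_derivative ?G) (at (f x))" and F: "(f has_derivative ?F) (at x)"
      using Suc.prems \<open>x \<in> S\<close> fT by (blast intro: Ck_on_Suc_has_derivative)+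
    have "?G (?F w) = (\<Sum>b\<in>Basis. (?F w \<bullet> b) *\<^sub>R ?G b)" for w
      by (subst euclidean_representation[of "?F w", symmetric])
        (simp add: linear_sum[OF has_derivative_linear[OF G]] linear_cmul[OF has_derivative_linear[OF G]])
    with has_derivative_compose[OF F G]
    show "((\<lambda>x. g (f x)) has_derivative (\<lambda>w. \<Sum>b\<in>Basis. (?F w \<bullet> b) *\<^sub>R ?G b)) (at x)"
      by simp
  next
    fix w
    show "Ck_on k S (\<lambda>x. \<Sum>b\<in>Basis. (frechet_derivative f (at x) w \<bullet> b) *\<^sub>R
        frechet_derivative g (at (f x)) b)"
    proof (intro Ck_on_sum Ck_on_bilinear[OF bounded_bilinear_scaleR] assms(1))
      show "Ck_on k S (\<lambda>x. frechet_derivative f (at x) w \<bullet> b)" for b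
        using Suc.prems by (intro Ck_on_bounded_linear[OF bounded_linear_inner_left] assms(1)) simp
      show "Ck_on k S (\<lambda>x. frechet_derivative g (at (f x)) b)" for b
        using Suc.prems Ck_on_Suc_imp by (intro Suc.IH) simp_all
    qed
  qed
qed

section \<open>The same properties for maps of every order\<close>

lemma smooth_on_subset: "smooth_on S f \<Longrightarrow> T \<subseteq> S \<Longrightarrow> smooth_on T f"
  by (auto simp: smooth_on_def intro: Ck_on_subset)

lemma smooth_on_cong: "open S \<Longrightarrow> (\<And>x. x \<in> S \<Longrightarrow> f x = g x) \<Longrightarrow> smooth_on S f \<longleftrightarrow> smooth_on S g"
  using Ck_on_cong unfolding smooth_on_def by blast

lemma smooth_on_const: "open S \<Longrightarrow> smooth_on S (\<lambda>x. c)"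
  by (simp add: smooth_on_def Ck_on_const)

lemma smooth_on_linear: "bounded_linear h \<Longrightarrow> open S \<Longrightarrow> smooth_on S h"
  by (simp add: smooth_on_def Ck_on_linear)

lemma smooth_on_bounded_linear:
  "bounded_linear h \<Longrightarrow> open S \<Longrightarrow> smooth_on S f \<Longrightarrow> smooth_on S (\<lambda>x. h (f x))"
  by (simp add: smooth_on_def Ck_on_bounded_linear)

lemma smooth_on_add:
  "open S \<Longrightarrow> smooth_on S f \<Longrightarrow> smooth_on S g \<Longrightarrow> smooth_on S (\<lambda>x. f x + g x)"
  by (simp add: smooth_on_def Ck_on_add)

lemma smooth_on_Pair:
  "open S \<Longrightarrow> smooth_on S f \<Longrightarrow> smooth_on S g \<Longrightarrow> smooth_on S (\<lambda>x. (f x, g x))"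
  by (simp add: smooth_on_def Ck_on_Pair)

lemma smooth_on_bilinear:
  "bounded_bilinear p \<Longrightarrow> open S \<Longrightarrow> smooth_on S f \<Longrightarrow> smooth_on S g \<Longrightarrow>
    smooth_on S (\<lambda>x. p (f x) (g x))"
  by (simp add: smooth_on_def Ck_on_bilinear)

lemma smooth_on_vec_lambda:
  fixes f :: "'n::finite \<Rightarrow> 'a::real_normed_vector \<Rightarrow> real"
  assumes "open S" "\<And>i. smooth_on S (f i)"
  shows "smooth_on S (\<lambda>x. \<chi> i. f i x)"
proof -
  have "smooth_on S (\<lambda>x. \<Sum>i\<in>UNIV. f i x *\<^sub>R axis i (1::real))"
    unfolding smooth_on_def using assms
    by (intro allI Ck_on_sum Ck_on_bounded_linear[OF bounded_linear_scaleR_left]) (auto simp: smooth_on_def)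
  moreover have "(\<Sum>i\<in>UNIV. f i x *\<^sub>R axis i (1::real)) = (\<chi> i. f i x)" for x
    using basis_expansion[of "\<chi> i. f i x"] by (simp add: scalar_mult_eq_scaleR)
  ultimately show ?thesis by simp
qed

lemma smooth_on_compose:
  fixes f :: "'a::real_normed_vector \<Rightarrow> 'b::euclidean_space"
    and g :: "'b \<Rightarrow> 'c::real_normed_vector"
  assumes "smooth_on T g" "smooth_on S f" "open S" "f ` S \<subseteq> T"
  shows "smooth_on S (\<lambda>x. g (f x))"
  unfolding smooth_on_def
proof
  fix k
  show "Ck_on k S (\<lambda>x. g (f x))"
    by (rule Ck_on_compose[OF assms(3,4)]) (use assms(1,2) in \<open>auto simp only: smooth_on_def\<close>)
qed

lemma smooth_on_imp_continuous_on: "smooth_on S f \<Longrightarrow> continuous_on S f"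
  using smooth_on_def Ck_on.simps(1) by metis

lemma smooth_on_has_derivative:
  assumes "smooth_on S f" "x \<in> S"
  shows "(f has_derivative frechet_derivative f (at x)) (at x)"
  using assms Ck_on_Suc_has_derivative smooth_on_def by metis

lemma smooth_on_imp_differentiable: "smooth_on S f \<Longrightarrow> x \<in> S \<Longrightarrow> f differentiable (at x)"
  using smooth_on_has_derivative differentiable_def by blast

lemma smooth_on_frechet_derivative:
  "smooth_on S f \<Longrightarrow> smooth_on S (\<lambda>x. frechet_derivative f (at x) w)"
  unfolding smooth_on_def using Ck_on.simps(2) by metis

text \<open>The conclusion of the theorem is phrased with derivatives along coordinate lines, the
  geometry with total derivatives; the chain rule along the line \<open>z + r *\<^sub>R b\<close>
  identifies them.\<close>

lemma partial_eq_frechet_derivative: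
  assumes "f differentiable (at z)"
  shows "partial f b z = frechet_derivative f (at z) b"
proof -
  let ?D = "frechet_derivative f (at z)"
  have "((\<lambda>r::real. z + r *\<^sub>R b) has_derivative (\<lambda>r. r *\<^sub>R b)) (at 0)"
    by (auto intro!: derivative_eq_intros)
  moreover have D: "(f has_derivative ?D) (at (z + 0 *\<^sub>R b))"
    using assms frechet_derivative_works by auto
  ultimately have "((\<lambda>r. f (z + r *\<^sub>R b)) has_derivative (\<lambda>r. ?D (r *\<^sub>R b))) (at 0)"
    by (rule has_derivative_compose)
  moreover have "?D (r *\<^sub>R b) = ?D b * r" for r
    using linear_cmul[OF has_derivative_linear[OF D]] by simp
  ultimately have "((\<lambda>r. f (z + r *\<^sub>R b)) has_field_derivative ?D b) (at 0)"
    by (simp add: has_field_derivative_def)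
  then show ?thesis unfolding partial_def by (rule DERIV_imp_deriv)
qed

section \<open>Dual families and level sets\<close>

text \<open>A nonzero value of the wedge is a nonzero determinant of the matrix of values on some
  vectors \<open>Y\<close>. The columns of the inverse matrix are the coefficients with which the
  \<open>Y\<close> combine to a dual family.\<close>

lemma wedge_dual_family:
  fixes \<omega> :: "'s::finite \<Rightarrow> 'a::real_vector \<Rightarrow> real"
  assumes lin: "\<And>\<alpha>. linear (\<omega> \<alpha>)" and "wedge \<omega> \<noteq> (\<lambda>_. 0)"
  obtains X where "\<And>\<alpha> \<beta>. \<omega> \<alpha> (X \<beta>) = (if \<alpha> = \<beta> then 1 else 0)"
proof -
  obtain Y where "wedge \<omega> Y \<noteq> 0" using assms(2) by auto
  define A where "A = (\<chi> \<alpha> \<beta>. \<omega> \<alpha> (Y \<beta>))"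
  have "invertible A" using \<open>wedge \<omega> Y \<noteq> 0\<close> by (simp add: A_def wedge_def invertible_det_nz)
  then obtain B where inv: "A ** B = mat 1" unfolding invertible_def by blast
  have "\<omega> \<alpha> (\<Sum>\<gamma>\<in>UNIV. B $ \<gamma> $ \<beta> *\<^sub>R Y \<gamma>) = (A ** B) $ \<alpha> $ \<beta>" for \<alpha> \<beta>
    by (simp add: linear_sum[OF lin] linear_cmul[OF lin] A_def matrix_matrix_mult_def mult.commute)
  then show ?thesis
    unfolding inv by (intro that[of "\<lambda>\<beta>. \<Sum>\<gamma>\<in>UNIV. B $ \<gamma> $ \<beta> *\<^sub>R Y \<gamma>"]) (simp add: mat_def)
qed

text \<open>Removing from \<open>h\<close> its components along a dual family \<open>X\<close>
  leaves a vector of the common kernel, where \<open>\<theta>\<close> vanishes. The coefficients are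
  therefore the values \<open>\<theta> (X \<alpha>)\<close>.\<close>

lemma covector_in_span:
  fixes \<omega> :: "'s::finite \<Rightarrow> 'a::real_vector \<Rightarrow> real"
  assumes "\<And>\<alpha>. linear (\<omega> \<alpha>)" "linear \<theta>"
    and "wedge \<omega> \<noteq> (\<lambda>_. 0)" and ker: "\<And>h. (\<And>\<alpha>. \<omega> \<alpha> h = 0) \<Longrightarrow> \<theta> h = 0"
  obtains c where "\<And>h. \<theta> h = (\<Sum>\<alpha>\<in>UNIV. c \<alpha> * \<omega> \<alpha> h)"
proof -
  obtain X where X: "\<And>\<alpha> \<beta>. \<omega> \<alpha> (X \<beta>) = (if \<alpha> = \<beta> then 1 else 0)"
    using wedge_dual_family[of \<omega>] assms by blast
  have "\<theta> h = (\<Sum>\<alpha>\<in>UNIV. \<theta> (X \<alpha>) * \<omega> \<alpha> h)" for h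
  proof -
    have "\<theta> (h - (\<Sum>\<beta>\<in>UNIV. \<omega> \<beta> h *\<^sub>R X \<beta>)) = 0"
    proof (rule ker)
      fix \<alpha>
      show "\<omega> \<alpha> (h - (\<Sum>\<beta>\<in>UNIV. \<omega> \<beta> h *\<^sub>R X \<beta>)) = 0"
        by (simp add: linear_diff[OF assms(1)] linear_sum[OF assms(1)] linear_cmul[OF assms(1)] X
            if_distrib[of "\<lambda>t. _ * t"] cong: if_cong)
    qed
    then show ?thesis
      by (simp add: linear_diff[OF assms(2)] linear_sum[OF assms(2)] linear_cmul[OF assms(2)] mult.commute)
  qed
  then show ?thesis by (rule that)
qed

text \<open>With \<open>X\<close> dual to the differentials \<open>\<omega>\<close> of \<open>\<Psi>\<close> at \<open>z\<close>, the map
  \<open>x \<mapsto> (x - z) + \<Sum>\<beta>. (\<Psi> \<beta> x - \<omega> \<beta> (x - z)) X\<^sub>\<beta>\<close> has the identity as derivative at \<open>z\<close> and maps the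
  zero set of \<open>\<Psi>\<close> to the kernel of \<open>\<omega>\<close>; its local inverse takes a line in the kernel to the curve.\<close>
lemma curve_in_level_set:
  fixes \<Psi> :: "'s::finite \<Rightarrow> 'a::euclidean_space \<Rightarrow> real"
  defines "\<omega> \<equiv> \<lambda>z \<alpha>. frechet_derivative (\<Psi> \<alpha>) (at z)"
  assumes "open D" "z \<in> D" and smooth: "\<And>\<alpha>. smooth_on D (\<Psi> \<alpha>)" and zero: "\<And>\<alpha>. \<Psi> \<alpha> z = 0"
    and "wedge (\<omega> z) \<noteq> (\<lambda>_. 0)" and h: "\<And>\<alpha>. \<omega> z \<alpha> h = 0"
  obtains c where "c 0 = z" "(c has_vector_derivative h) (at 0)"
    "\<forall>\<^sub>F s in nhds 0. c s \<in> D \<and> (\<forall>\<alpha>. \<Psi> \<alpha> (c s) = 0)"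
proof -
  have der: "(\<Psi> \<alpha> has_derivative \<omega> x \<alpha>) (at x)" if "x \<in> D" for x \<alpha>
    unfolding \<omega>_def by (rule smooth_on_has_derivative[OF smooth that])
  have lin: "linear (\<omega> z \<alpha>)" and blin: "bounded_linear (\<omega> z \<alpha>)" for \<alpha>
    using der[OF \<open>z \<in> D\<close>] has_derivative_linear has_derivative_bounded_linear by blast+
  obtain X where X: "\<And>\<alpha> \<beta>. \<omega> z \<alpha> (X \<beta>) = (if \<alpha> = \<beta> then 1 else 0)"
    using wedge_dual_family[of "\<omega> z"] lin assms(6) by blast
  define f where "f x = (x - z) + (\<Sum>\<beta>\<in>UNIV. (\<Psi> \<beta> x - \<omega> z \<beta> (x - z)) *\<^sub>R X \<beta>)" for x
  define f' where "f' x k = k + (\<Sum>\<beta>\<in>UNIV. (\<omega> x \<beta> k - \<omega> z \<beta> k) *\<^sub>R X \<beta>)" for x k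
  have f': "(f has_derivative f' x) (at x)" if "x \<in> D" for x
    unfolding f_def f'_def
    by (auto intro!: derivative_eq_intros der[OF that] bounded_linear.has_derivative[OF blin])
  have apply_f': "blinfun_apply (Blinfun (f' x)) = f' x" if "x \<in> D" for x
    using has_derivative_bounded_linear[OF f'[OF that]] by (rule bounded_linear_Blinfun_apply)
  have f'_z: "f' z = (\<lambda>k. k)" by (simp add: f'_def fun_eq_iff)
  \<comment> \<open>The inverse function theorem needs the derivative to be continuous as an
    operator-valued map. In finite dimension it suffices to test it on basis vectors, where it is
    built from directional derivatives of the smooth \<open>\<Psi>\<close>.\<close>
  have cont: "continuous_on D (\<lambda>x. Blinfun (f' x))"
  proof (rule continuous_on_blinfun_componentwise)
    fix i :: 'a
    have "continuous_on D (\<lambda>x. \<omega> x \<beta> i)" for \<beta>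
      unfolding \<omega>_def by (intro smooth_on_imp_continuous_on smooth_on_frechet_derivative smooth)
    then have "continuous_on D (\<lambda>x. f' x i)"
      unfolding f'_def by (intro continuous_intros)
    then show "continuous_on D (\<lambda>x. blinfun_apply (Blinfun (f' x)) i)"
      by (rule continuous_on_eq) (simp add: apply_f')
  qed
  have inv: "id_blinfun o\<^sub>L Blinfun (f' z) = id_blinfun"
    by (rule blinfun_eqI) (metis (no_types) apply_f'[OF \<open>z \<in> D\<close>] f'_z blinfun_apply_blinfun_compose blinfun_apply_id_blinfun)
  obtain U V g g' where U: "U \<subseteq> D" "z \<in> U" and V: "open V" "f z \<in> V"
    and hom: "homeomorphism U V f g" and g: "\<And>y. y \<in> V \<Longrightarrow> (g has_derivative g' y) (at y)"
    and g': "\<And>y. y \<in> V \<Longrightarrow> g' y = inv (blinfun_apply (Blinfun (f' (g y))))"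
  proof (rule inverse_function_theorem[OF \<open>open D\<close> _ cont \<open>z \<in> D\<close> inv])
    show "(f has_derivative blinfun_apply (Blinfun (f' x))) (at x)" if "x \<in> D" for x
      using f'[OF that] apply_f'[OF that] by simp
  qed (rule that)
  have fz: "f z = 0" by (simp add: f_def zero linear_0[OF lin])
  have gz: "g 0 = z" using hom U(2) fz by (metis homeomorphism_apply1)
  \<comment> \<open>The derivative of \<open>f\<close> at \<open>z\<close> is the identity, hence so
    is that of its inverse at \<open>f z = 0\<close>. This is why the image of the line through
    \<open>h\<close> has velocity exactly \<open>h\<close>.\<close>
  have g0: "(g has_derivative (\<lambda>k. k)) (at 0)"
  proof -
    have "0 \<in> V" using V(2) fz by simp
    then have "g' 0 = (\<lambda>k. k)"
      using g'[OF \<open>0 \<in> V\<close>] gz apply_f'[OF \<open>z \<in> D\<close>] f'_z by (simp add: inv_unique_comp comp_def id_def)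
    then show ?thesis using g[OF \<open>0 \<in> V\<close>] by simp
  qed
  show ?thesis
  proof (rule that[of "\<lambda>s. g (s *\<^sub>R h)"])
    show "g (0 *\<^sub>R h) = z" using gz by simp
    have "((\<lambda>s. s *\<^sub>R h) has_derivative (\<lambda>s. s *\<^sub>R h)) (at (0::real))"
      by (auto intro!: derivative_eq_intros)
    from has_derivative_compose[OF this] g0
    show "((\<lambda>s. g (s *\<^sub>R h)) has_vector_derivative h) (at 0)"
      by (simp add: has_vector_derivative_def)
    have "open ((\<lambda>s::real. s *\<^sub>R h) -` V)"
      by (intro open_vimage V(1) continuous_intros)
    moreover have "0 \<in> (\<lambda>s::real. s *\<^sub>R h) -` V" using V(2) fz by simp
    moreover have "g (s *\<^sub>R h) \<in> D \<and> (\<forall>\<alpha>. \<Psi> \<alpha> (g (s *\<^sub>R h)) = 0)"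
      if "s \<in> (\<lambda>s. s *\<^sub>R h) -` V" for s
    proof -
      have sV: "s *\<^sub>R h \<in> V" using that by simp
      then have gU: "g (s *\<^sub>R h) \<in> U" and fg: "f (g (s *\<^sub>R h)) = s *\<^sub>R h"
        using hom by (auto simp: homeomorphism_def)
      \<comment> \<open>By duality the terms \<open>\<omega> z \<alpha> (x - z)\<close> cancel. So a
        point whose image under \<open>f\<close> lies in the kernel is a common zero of the
        \<open>\<Psi>\<close>, and the multiples of \<open>h\<close> are such images.\<close>
      have "\<omega> z \<alpha> (f x) = \<Psi> \<alpha> x" for \<alpha> x
        by (simp add: f_def linear_add[OF lin] linear_sum[OF lin] linear_cmul[OF lin] X
            if_distrib[of "\<lambda>t. _ * t"] cong: if_cong)
      from this[of _ "g (s *\<^sub>R h)"] have "\<Psi> \<alpha> (g (s *\<^sub>R h)) = 0" for \<alpha>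
        by (metis fg h linear_cmul[OF lin] scaleR_zero_right)
      with gU U(1) show ?thesis by auto
    qed
    ultimately show "\<forall>\<^sub>F s in nhds 0. g (s *\<^sub>R h) \<in> D \<and> (\<forall>\<alpha>. \<Psi> \<alpha> (g (s *\<^sub>R h)) = 0)"
      unfolding eventually_nhds by blast
  qed
qed

section \<open>Charts, curves and velocities\<close>

lemma smooth_atlas_chart:
  assumes "smooth_atlas A" "\<kappa> \<in> A"
  shows "inj_on (snd \<kappa>) (fst \<kappa>)" "open (snd \<kappa> ` fst \<kappa>)"
  using assms by (auto simp: smooth_atlas_def)

lemma smooth_atlas_overlap:
  assumes "smooth_atlas A" "\<kappa> \<in> A" "\<kappa>' \<in> A"
  shows "open (snd \<kappa> ` (fst \<kappa> \<inter> fst \<kappa>'))"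
    "smooth_on (snd \<kappa> ` (fst \<kappa> \<inter> fst \<kappa>')) (transition \<kappa> \<kappa>')"
  using assms by (auto simp: smooth_atlas_def)

lemma smooth_atlas_subset: "smooth_atlas B \<Longrightarrow> A \<subseteq> B \<Longrightarrow> smooth_atlas A"
  unfolding smooth_atlas_def by blast

lemma chart_inv_apply: "inj_on (snd \<kappa>) (fst \<kappa>) \<Longrightarrow> x \<in> fst \<kappa> \<Longrightarrow> chart_inv \<kappa> (snd \<kappa> x) = x"
  by (simp add: chart_inv_def)

lemma transition_apply:
  "inj_on (snd \<kappa>) (fst \<kappa>) \<Longrightarrow> x \<in> fst \<kappa> \<Longrightarrow> transition \<kappa> \<kappa>' (snd \<kappa> x) = snd \<kappa>' x"
  by (simp add: transition_def chart_inv_apply)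

lemma transition_has_derivative:
  assumes "smooth_atlas A" "\<kappa> \<in> A" "\<kappa>' \<in> A" "x \<in> fst \<kappa>" "x \<in> fst \<kappa>'"
  shows "(transition \<kappa> \<kappa>' has_derivative frechet_derivative (transition \<kappa> \<kappa>') (at (snd \<kappa> x)))
    (at (snd \<kappa> x))"
  using smooth_atlas_overlap(2)[OF assms(1-3)] assms(4,5) by (intro smooth_on_has_derivative) auto

lemma frechet_derivative_transition_trans:
  assumes A: "smooth_atlas A" "\<kappa> \<in> A" "\<kappa>' \<in> A" "\<kappa>'' \<in> A"
    and x: "x \<in> fst \<kappa>" "x \<in> fst \<kappa>'" "x \<in> fst \<kappa>''"
  shows "frechet_derivative (transition \<kappa>' \<kappa>'') (at (snd \<kappa>' x))
      (frechet_derivative (transition \<kappa> \<kappa>') (at (snd \<kappa> x)) w) =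
    frechet_derivative (transition \<kappa> \<kappa>'') (at (snd \<kappa> x)) w"
proof -
  have inj: "inj_on (snd \<kappa>) (fst \<kappa>)" "inj_on (snd \<kappa>') (fst \<kappa>')"
    using A smooth_atlas_chart by blast+
  \<comment> \<open>An atlas declares only pairwise overlaps to be open, so the triple overlap is
    taken as an intersection of two images; injectivity of the chart recovers one point lying in all
    three domains.\<close>
  let ?O = "snd \<kappa> ` (fst \<kappa> \<inter> fst \<kappa>') \<inter> snd \<kappa> ` (fst \<kappa> \<inter> fst \<kappa>'')"
  have O: "open ?O" "snd \<kappa> x \<in> ?O"
    using A x smooth_atlas_overlap(1) by blast+
  have eq: "transition \<kappa>' \<kappa>'' (transition \<kappa> \<kappa>' y) = transition \<kappa> \<kappa>'' y" if "y \<in> ?O" for y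
  proof -
    have "y \<in> snd \<kappa> ` ((fst \<kappa> \<inter> fst \<kappa>') \<inter> (fst \<kappa> \<inter> fst \<kappa>''))"
      using that inj_on_image_Int[OF inj(1), of "fst \<kappa> \<inter> fst \<kappa>'" "fst \<kappa> \<inter> fst \<kappa>''"] by simp
    then obtain a where "y = snd \<kappa> a" "a \<in> fst \<kappa>" "a \<in> fst \<kappa>'" "a \<in> fst \<kappa>''" by blast
    then show ?thesis using inj by (simp add: transition_apply)
  qed
  have "((\<lambda>y. transition \<kappa>' \<kappa>'' (transition \<kappa> \<kappa>' y)) has_derivative
      (\<lambda>w. frechet_derivative (transition \<kappa>' \<kappa>'') (at (snd \<kappa>' x))
        (frechet_derivative (transition \<kappa> \<kappa>') (at (snd \<kappa> x)) w))) (at (snd \<kappa> x))"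
    using transition_has_derivative[OF A(1,3,4) x(2,3)]
    by (intro has_derivative_compose[OF transition_has_derivative[OF A(1-3) x(1,2)]])
      (simp add: transition_apply[OF inj(1) x(1)])
  then have "(transition \<kappa> \<kappa>'' has_derivative
      (\<lambda>w. frechet_derivative (transition \<kappa>' \<kappa>'') (at (snd \<kappa>' x))
        (frechet_derivative (transition \<kappa> \<kappa>') (at (snd \<kappa> x)) w))) (at (snd \<kappa> x))"
    by (rule has_derivative_transform_within_open[OF _ O eq])
  from frechet_derivative_at[OF this] show ?thesis by metis
qed

lemma frechet_derivative_transition_self:
  assumes A: "smooth_atlas A" "\<kappa> \<in> A" "x \<in> fst \<kappa>"
  shows "frechet_derivative (transition \<kappa> \<kappa>) (at (snd \<kappa> x)) = (\<lambda>w. w)"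
proof -
  have "((\<lambda>y. y) has_derivative (\<lambda>w. w)) (at (snd \<kappa> x))" by simp
  then have "(transition \<kappa> \<kappa> has_derivative (\<lambda>w. w)) (at (snd \<kappa> x))"
    by (rule has_derivative_transform_within_open[OF _ smooth_atlas_chart(2)[OF A(1,2)]])
      (use A in \<open>auto simp: transition_apply smooth_atlas_chart(1)\<close>)
  from frechet_derivative_at[OF this] show ?thesis by simp
qed

section \<open>Smooth curves and their velocities\<close>

lemma chart_inv_real_line: "chart_inv (UNIV, \<lambda>t. t) = (\<lambda>t. t)"
  by (simp add: chart_inv_def inv_into_def fun_eq_iff)

lemma smooth_at_real_lineI:
  assumes "\<kappa> \<in> A" "open N" "t \<in> N" "\<And>s. s \<in> N \<Longrightarrow> c s \<in> fst \<kappa>" "smooth_on N (\<lambda>s. snd \<kappa> (c s))"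
  shows "smooth_at real_line A c t"
proof -
  have "\<kappa> \<in> charts_at A (c t)" using assms(1,3,4) by (simp add: charts_at_def)
  moreover have "(UNIV, \<lambda>t. t) \<in> charts_at real_line t" by (simp add: charts_at_def real_line_def)
  ultimately show ?thesis
    unfolding smooth_at_def
    by (intro bexI[of _ \<kappa>] bexI[of _ "(UNIV, \<lambda>t. t)"] exI[of _ N]) (use assms(2-5) in \<open>auto simp: chart_inv_real_line\<close>)
qed

text \<open>\<open>smooth_at\<close> provides smoothness in one chart of unknown identity. Composing
  with a transition map carries it to any chart around the point, after shrinking to the times at
  which the curve is in the overlap.\<close>

lemma smooth_at_real_lineE:
  assumes A: "smooth_atlas A" and c: "smooth_at real_line A c t" and \<kappa>: "\<kappa> \<in> A" "c t \<in> fst \<kappa>"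
  obtains N where "open N" "t \<in> N" "\<And>s. s \<in> N \<Longrightarrow> c s \<in> fst \<kappa>" "smooth_on N (\<lambda>s. snd \<kappa> (c s))"
proof -
  obtain \<nu> N where \<nu>: "\<nu> \<in> A" "c t \<in> fst \<nu>" and N: "open N" "t \<in> N"
    "\<And>s. s \<in> N \<Longrightarrow> c s \<in> fst \<nu>" "smooth_on N (\<lambda>s. snd \<nu> (c s))"
    using c by (auto simp: smooth_at_def charts_at_def real_line_def chart_inv_real_line)
  let ?O = "snd \<nu> ` (fst \<nu> \<inter> fst \<kappa>)"
  let ?N = "N \<inter> (\<lambda>s. snd \<nu> (c s)) -` ?O"
  have inj: "inj_on (snd \<nu>) (fst \<nu>)" using A \<nu> smooth_atlas_chart by blast
  have "open ?N"
    using continuous_open_preimage[OF smooth_on_imp_continuous_on[OF N(4)] N(1)]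
      smooth_atlas_overlap(1)[OF A \<nu>(1) \<kappa>(1)] by blast
  moreover have "t \<in> ?N" using N(2) \<nu>(2) \<kappa>(2) by auto
  moreover have c\<kappa>: "c s \<in> fst \<kappa>" if "s \<in> ?N" for s
    using that N(3)[of s] inj by (auto dest: inj_onD)
  moreover have "smooth_on ?N (\<lambda>s. snd \<kappa> (c s))"
  proof -
    have "smooth_on ?N (\<lambda>s. snd \<nu> (c s))" using N(4) by (rule smooth_on_subset) auto
    then have "smooth_on ?N (\<lambda>s. transition \<nu> \<kappa> (snd \<nu> (c s)))"
      by (rule smooth_on_compose[OF smooth_atlas_overlap(2)[OF A \<nu>(1) \<kappa>(1)] _ \<open>open ?N\<close>]) auto
    moreover have "transition \<nu> \<kappa> (snd \<nu> (c s)) = snd \<kappa> (c s)" if "s \<in> ?N" for s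
      using that N(3)[of s] inj by (intro transition_apply) auto
    ultimately show ?thesis by (rule smooth_on_cong[OF \<open>open ?N\<close>, THEN iffD1, rotated])
  qed
  ultimately show ?thesis by (rule that)
qed

lemma has_vector_derivative_compose:
  assumes "(f has_vector_derivative f') (at t)" "(g has_derivative g') (at (f t))"
  shows "((\<lambda>s. g (f s)) has_vector_derivative g' f') (at t)"
  using has_derivative_compose[OF assms(1)[unfolded has_vector_derivative_def] assms(2)]
    linear_cmul[OF has_derivative_linear[OF assms(2)]]
  by (simp add: has_vector_derivative_def)

lemma smooth_at_real_line_differentiable:
  assumes "smooth_atlas A" "smooth_at real_line A c t" "\<kappa> \<in> A" "c t \<in> fst \<kappa>"
  shows "((\<lambda>s. snd \<kappa> (c s)) has_vector_derivative velocity A c t \<kappa>) (at t)"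
proof -
  obtain N where "t \<in> N" "smooth_on N (\<lambda>s. snd \<kappa> (c s))"
    by (rule smooth_at_real_lineE[OF assms])
  then have "(\<lambda>s. snd \<kappa> (c s)) differentiable (at t)" by (metis smooth_on_imp_differentiable)
  then show ?thesis
    using assms(3,4) by (simp add: velocity_def charts_at_def comp_def vector_derivative_works)
qed

lemma velocity_transition:
  assumes A: "smooth_atlas A" and c: "smooth_at real_line A c t"
    and \<kappa>: "\<kappa> \<in> A" "\<kappa>' \<in> A" "c t \<in> fst \<kappa>" "c t \<in> fst \<kappa>'"
  shows "velocity A c t \<kappa>' = frechet_derivative (transition \<kappa> \<kappa>') (at (snd \<kappa> (c t))) (velocity A c t \<kappa>)"
proof -
  obtain N where N: "open N" "t \<in> N" "\<And>s. s \<in> N \<Longrightarrow> c s \<in> fst \<kappa>"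
    by (rule smooth_at_real_lineE[OF A c \<kappa>(1,3)]) (rule that)
  let ?T = "transition \<kappa> \<kappa>'"
  have inj: "inj_on (snd \<kappa>) (fst \<kappa>)" using A \<kappa> smooth_atlas_chart by blast
  have "((\<lambda>s. ?T (snd \<kappa> (c s))) has_vector_derivative
      frechet_derivative ?T (at (snd \<kappa> (c t))) (velocity A c t \<kappa>)) (at t)"
    by (rule has_vector_derivative_compose[OF smooth_at_real_line_differentiable[OF A c \<kappa>(1,3)]
        transition_has_derivative[OF A \<kappa>]])
  then have "((\<lambda>s. snd \<kappa>' (c s)) has_vector_derivative
      frechet_derivative ?T (at (snd \<kappa> (c t))) (velocity A c t \<kappa>)) (at t)"
    by (rule has_vector_derivative_transform_within_open[OF _ N(1,2)])
      (simp add: transition_apply[OF inj] N(3))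
  with smooth_at_real_line_differentiable[OF A c \<kappa>(2,4)] show ?thesis
    by (rule vector_derivative_unique_at)
qed

lemma velocity_in_tangent_space:
  assumes "smooth_atlas A" "smooth_at real_line A c t"
  shows "velocity A c t \<in> tangent_space A (c t)"
  unfolding tangent_space_def mem_Collect_eq
proof (intro conjI allI ballI impI)
  show "velocity A c t \<kappa> = 0" if "\<kappa> \<notin> charts_at A (c t)" for \<kappa>
    using that by (simp add: velocity_def)
qed (rule velocity_transition[OF assms]; simp add: charts_at_def)

text \<open>\<open>tangent_map\<close> evaluates in an arbitrarily chosen chart
  \<open>\<nu>\<close>. Near the point, the expression of \<open>f\<close> in \<open>\<nu>\<close>
  is the transition to \<open>\<kappa>\<close> followed by \<open>P\<close>, so its derivative turns
  \<open>\<nu>\<close>-components of the velocity into \<open>\<kappa>\<close>-components and then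
  applies \<open>P\<close>.\<close>

lemma tangent_map_velocity:
  assumes A: "smooth_atlas A" "\<kappa> \<in> A" "c t \<in> fst \<kappa>" and c: "smooth_at real_line A c t"
    and \<mu>: "\<mu> \<in> charts_at B (f (c t))"
    and P: "bounded_linear P" "\<And>x. x \<in> fst \<kappa> \<Longrightarrow> snd \<mu> (f x) = P (snd \<kappa> x)"
  shows "tangent_map A B f (c t) (velocity A c t) \<mu> = P (velocity A c t \<kappa>)"
proof -
  define \<nu> where "\<nu> = (SOME \<nu>. \<nu> \<in> charts_at A (c t))"
  have "\<nu> \<in> charts_at A (c t)" unfolding \<nu>_def by (rule someI[of _ \<kappa>]) (simp add: charts_at_def A)
  then have \<nu>: "\<nu> \<in> A" "c t \<in> fst \<nu>" by (auto simp: charts_at_def)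
  have inj: "inj_on (snd \<nu>) (fst \<nu>)" using A \<nu> smooth_atlas_chart by blast
  let ?T = "transition \<nu> \<kappa>"
  have "((\<lambda>y. P (?T y)) has_derivative (\<lambda>w. P (frechet_derivative ?T (at (snd \<nu> (c t))) w)))
      (at (snd \<nu> (c t)))"
    by (intro bounded_linear.has_derivative[OF P(1)] transition_has_derivative[OF A(1) \<nu>(1) A(2) \<nu>(2) A(3)])
  then have "(snd \<mu> \<circ> f \<circ> chart_inv \<nu> has_derivative
      (\<lambda>w. P (frechet_derivative ?T (at (snd \<nu> (c t))) w))) (at (snd \<nu> (c t)))"
    by (rule has_derivative_transform_within_open[OF _ smooth_atlas_overlap(1)[OF A(1) \<nu>(1) A(2)]])
      (use \<nu> A(3) P(2) in \<open>auto simp: transition_apply[OF inj] chart_inv_apply[OF inj]\<close>)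
  from frechet_derivative_at[OF this, symmetric] show ?thesis
    using \<mu> velocity_transition[OF A(1) c \<nu>(1) A(2) \<nu>(2) A(3)]
    by (simp add: tangent_map_def \<nu>_def[symmetric])
qed

text \<open>The difference quotients lie in \<open>V\<close>, and subspaces of a Euclidean space are
  closed.\<close>

lemma has_vector_derivative_in_subspace:
  fixes c :: "real \<Rightarrow> 'b::euclidean_space"
  assumes "subspace V" "(c has_vector_derivative k) (at t)" "c t \<in> V" "\<forall>\<^sub>F s in at t. c s \<in> V"
  shows "k \<in> V"
proof -
  have "((\<lambda>s. (c s - c t) /\<^sub>R (s - t)) \<longlongrightarrow> k) (at t)"
  proof (rule Lim_null_comparison[THEN Lim_null[THEN iffD2]])
    show "((\<lambda>s. norm ((c s - c t - (s - t) *\<^sub>R k) /\<^sub>R norm (s - t))) \<longlongrightarrow> 0) (at t)"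
      using assms(2) unfolding has_vector_derivative_def has_derivative_at_within
      by (intro tendsto_norm_zero) simp
    have "norm ((c s - c t) /\<^sub>R (s - t) - k) \<le> norm ((c s - c t - (s - t) *\<^sub>R k) /\<^sub>R norm (s - t))"
      if "s \<noteq> t" for s
    proof -
      have "(c s - c t) /\<^sub>R (s - t) - k = (c s - c t - (s - t) *\<^sub>R k) /\<^sub>R (s - t)"
        using that by (simp add: scaleR_diff_right)
      then show ?thesis by simp
    qed
    then show "\<forall>\<^sub>F s in at t. norm ((c s - c t) /\<^sub>R (s - t) - k) \<le>
        norm ((c s - c t - (s - t) *\<^sub>R k) /\<^sub>R norm (s - t))"
      by (auto simp: eventually_at_filter)
  qed
  moreover have "\<forall>\<^sub>F s in at t. (c s - c t) /\<^sub>R (s - t) \<in> V"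
    using assms(4) by eventually_elim (use assms in \<open>auto intro: subspace_scale subspace_diff\<close>)
  ultimately show ?thesis
    using Lim_in_closed_set[OF closed_subspace[OF assms(1)]] by (metis trivial_limit_at)
qed

text \<open>In a slice chart the given curve has its velocity in the slice, and the straight line with this
  velocity is a smooth curve in the submanifold.\<close>
lemma submanifold_smooth_curve:
  assumes A: "\<kappa> \<in> A" and S: "submanifold A S" and x: "x \<in> S" "x \<in> fst \<kappa>"
    and c: "c 0 = snd \<kappa> x" "(c has_vector_derivative h) (at 0)"
      "\<forall>\<^sub>F s in nhds 0. c s \<in> snd \<kappa> ` (S \<inter> fst \<kappa>)"
  obtains y I where "open I" "0 \<in> I" "y 0 = x" "\<And>s. s \<in> I \<Longrightarrow> y s \<in> S" "\<And>s. s \<in> I \<Longrightarrow> y s \<in> fst \<kappa>"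
    "smooth_on I (\<lambda>s. snd \<kappa> (y s))" "((\<lambda>s. snd \<kappa> (y s)) has_vector_derivative h) (at 0)"
proof -
  obtain \<sigma> V where \<sigma>: "compatible_chart A \<sigma>" "x \<in> fst \<sigma>"
    and V: "subspace V" "snd \<sigma> ` (S \<inter> fst \<sigma>) = snd \<sigma> ` fst \<sigma> \<inter> V"
    using S x(1) unfolding submanifold_def by blast
  \<comment> \<open>The slice chart is only compatible with \<open>A\<close>, not a member of it; in
    the enlarged atlas the facts about transitions apply to both charts.\<close>
  let ?B = "insert \<sigma> A"
  have B: "smooth_atlas ?B" "\<kappa> \<in> ?B" "\<sigma> \<in> ?B"
    using \<sigma>(1) A by (auto simp: compatible_chart_def)
  have inj: "inj_on (snd \<kappa>) (fst \<kappa>)" "inj_on (snd \<sigma>) (fst \<sigma>)"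
    using B smooth_atlas_chart by blast+
  let ?T = "transition \<kappa> \<sigma>" and ?T' = "transition \<sigma> \<kappa>"
  let ?O = "snd \<kappa> ` (fst \<kappa> \<inter> fst \<sigma>)" and ?O' = "snd \<sigma> ` (fst \<sigma> \<inter> fst \<kappa>)"
  define k where "k = frechet_derivative ?T (at (snd \<kappa> x)) h"
  have Tc: "((\<lambda>s. ?T (c s)) has_vector_derivative k) (at 0)"
    unfolding k_def using transition_has_derivative[OF B x(2) \<sigma>(2)]
    by (intro has_vector_derivative_compose[OF c(2)]) (simp add: c(1))
  have inV: "?T z \<in> V" if z: "z \<in> snd \<kappa> ` (S \<inter> fst \<kappa>)" "z \<in> ?O" for z
  proof -
    obtain y where y: "y \<in> S" "y \<in> fst \<kappa>" "z = snd \<kappa> y" using z(1) by auto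
    then have "y \<in> fst \<sigma>" using z(2) inj(1) by (auto dest: inj_onD)
    then show ?thesis using y V(2) by (auto simp: transition_apply[OF inj(1)])
  qed
  have "k \<in> V"
  proof (rule has_vector_derivative_in_subspace[OF V(1) Tc])
    show "?T (c 0) \<in> V" using inV[of "c 0"] c(1) x \<sigma>(2) by auto
    have "isCont c 0" using c(2) has_vector_derivative_continuous by blast
    then have "\<forall>\<^sub>F s in at 0. c s \<in> ?O"
      using smooth_atlas_overlap(1)[OF B] x \<sigma>(2) c(1)
      by (intro topological_tendstoD[where l="c 0"]) (auto simp: isCont_def)
    moreover have "\<forall>\<^sub>F s in at 0. c s \<in> snd \<kappa> ` (S \<inter> fst \<kappa>)"
      using c(3) by (auto simp: eventually_at_filter elim: eventually_mono)
    ultimately show "\<forall>\<^sub>F s in at 0. ?T (c s) \<in> V"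
      by eventually_elim (rule inV)
  qed
  define b where "b s = snd \<sigma> x + s *\<^sub>R k" for s
  define y where "y s = chart_inv \<sigma> (b s)" for s
  define I where "I = b -` ?O'"
  have "open I" unfolding I_def b_def
    by (intro open_vimage smooth_atlas_overlap(1)[OF B(1,3,2)] continuous_intros)
  have "0 \<in> I" using x \<sigma>(2) by (auto simp: I_def b_def)
  have yI: "y s \<in> fst \<sigma>" "y s \<in> fst \<kappa>" "b s = snd \<sigma> (y s)" if "s \<in> I" for s
    using that inj(2) by (auto simp: I_def y_def chart_inv_apply)
  have \<kappa>y: "snd \<kappa> (y s) = ?T' (b s)" for s by (simp add: y_def transition_def)
  have yS: "y s \<in> S" if "s \<in> I" for s
  proof -
    have "snd \<sigma> x \<in> V" using V(2) x \<sigma>(2) by blast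
    then have "b s \<in> V"
      unfolding b_def by (intro subspace_add[OF V(1)] subspace_scale[OF V(1)] \<open>k \<in> V\<close>)
    then have "snd \<sigma> (y s) \<in> snd \<sigma> ` (S \<inter> fst \<sigma>)" using V(2) yI[OF that] by auto
    then show ?thesis using inj(2) yI(1)[OF that] by (auto dest: inj_onD)
  qed
  have smooth: "smooth_on I (\<lambda>s. snd \<kappa> (y s))"
    unfolding \<kappa>y
  proof (rule smooth_on_compose[OF smooth_atlas_overlap(2)[OF B(1,3,2)]])
    show "smooth_on I b"
      unfolding b_def
      by (intro smooth_on_add smooth_on_const smooth_on_linear \<open>open I\<close> bounded_linear_scaleR_left)
    show "open I" "b ` I \<subseteq> ?O'" using \<open>open I\<close> by (auto simp: I_def)
  qed
  have vel: "((\<lambda>s. snd \<kappa> (y s)) has_vector_derivative h) (at 0)"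
  proof -
    have b0: "b 0 = snd \<sigma> x" by (simp add: b_def)
    have b: "(b has_vector_derivative k) (at 0)"
      unfolding b_def by (auto intro!: derivative_eq_intros)
    have "((\<lambda>s. ?T' (b s)) has_vector_derivative frechet_derivative ?T' (at (snd \<sigma> x)) k) (at 0)"
      by (rule has_vector_derivative_compose[OF b])
        (simp add: b0 transition_has_derivative[OF B(1,3,2) \<sigma>(2) x(2)])
    \<comment> \<open>The Jacobians of the two transitions are inverse to each other, so the line
      with velocity \<open>k\<close> in the slice chart regains the velocity \<open>h\<close> in
      \<open>\<kappa>\<close>.\<close>
    moreover have "frechet_derivative ?T' (at (snd \<sigma> x)) k = h"
      unfolding k_def frechet_derivative_transition_trans[OF B(1,2,3,2) x(2) \<sigma>(2) x(2)]
        frechet_derivative_transition_self[OF B(1,2) x(2)] ..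
    ultimately show ?thesis by (simp add: \<kappa>y)
  qed
  have "y 0 = x" by (simp add: y_def b_def chart_inv_apply[OF inj(2) \<sigma>(2)])
  then show ?thesis by (rule that[OF \<open>open I\<close> \<open>0 \<in> I\<close> _ yS yI(2) smooth vel])
qed

text \<open>Compatibility of a slice chart already asserts that the atlas enlarged by it is smooth.
  A point of \<open>S\<close> is what guarantees that a slice chart exists.\<close>

lemma submanifold_smooth_atlas:
  assumes "submanifold A S" "x \<in> S"
  shows "smooth_atlas A"
proof -
  obtain \<sigma> where "compatible_chart A \<sigma>" using assms unfolding submanifold_def by blast
  then have "smooth_atlas (insert \<sigma> A)" by (simp add: compatible_chart_def)
  then show ?thesis by (rule smooth_atlas_subset) auto
qed

section \<open>Covectors and momenta\<close>

lemma tangent_vec_self: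
  "smooth_atlas A \<Longrightarrow> \<kappa> \<in> A \<Longrightarrow> x \<in> fst \<kappa> \<Longrightarrow> tangent_vec A \<kappa> x w \<kappa> = w"
  by (simp add: tangent_vec_def charts_at_def frechet_derivative_transition_self)

lemma tangent_vec_in_tangent_space:
  assumes A: "smooth_atlas A" "\<kappa> \<in> A" "x \<in> fst \<kappa>"
  shows "tangent_vec A \<kappa> x w \<in> tangent_space A x"
  unfolding tangent_space_def mem_Collect_eq
proof (intro conjI allI ballI impI)
  fix \<kappa>' \<kappa>''
  assume "\<kappa>' \<in> charts_at A x" "\<kappa>'' \<in> charts_at A x"
  then show "tangent_vec A \<kappa> x w \<kappa>'' =
      frechet_derivative (transition \<kappa>' \<kappa>'') (at (snd \<kappa>' x)) (tangent_vec A \<kappa> x w \<kappa>')"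
    using frechet_derivative_transition_trans[OF A(1,2) _ _ A(3), of \<kappa>' \<kappa>'' w]
    by (simp add: tangent_vec_def charts_at_def)
qed (simp add: tangent_vec_def)

lemma tangent_vec_of_components:
  assumes "\<kappa> \<in> A" "x \<in> fst \<kappa>" "X \<in> tangent_space A x"
  shows "tangent_vec A \<kappa> x (X \<kappa>) = X"
proof
  fix \<kappa>'
  have "\<kappa> \<in> charts_at A x" using assms(1,2) by (simp add: charts_at_def)
  then have "\<kappa>' \<in> charts_at A x \<Longrightarrow> X \<kappa>' = frechet_derivative (transition \<kappa> \<kappa>') (at (snd \<kappa> x)) (X \<kappa>)"
    and "\<kappa>' \<notin> charts_at A x \<Longrightarrow> X \<kappa>' = 0"
    using assms(3) unfolding tangent_space_def by blast+
  then show "tangent_vec A \<kappa> x (X \<kappa>) \<kappa>' = X \<kappa>'"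
    unfolding tangent_vec_def by metis
qed

lemma tangent_vec_change_chart:
  assumes "smooth_atlas A" "\<kappa> \<in> A" "\<kappa>' \<in> A" "x \<in> fst \<kappa>" "x \<in> fst \<kappa>'"
  shows "tangent_vec A \<kappa>' x w =
    tangent_vec A \<kappa> x (frechet_derivative (transition \<kappa>' \<kappa>) (at (snd \<kappa>' x)) w)"
proof -
  have "tangent_vec A \<kappa>' x w \<kappa> = frechet_derivative (transition \<kappa>' \<kappa>) (at (snd \<kappa>' x)) w"
    using assms(2,4) by (simp add: tangent_vec_def charts_at_def)
  with tangent_vec_of_components[OF assms(2,4) tangent_vec_in_tangent_space[OF assms(1,3,5)], of w]
  show ?thesis by simp
qed

lemma tangent_vec_combine:
  assumes "smooth_atlas A" "\<kappa> \<in> A" "x \<in> fst \<kappa>"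
  shows "tangent_vec A \<kappa> x (a *\<^sub>R w + b *\<^sub>R w') =
    (\<lambda>\<kappa>'. a *\<^sub>R tangent_vec A \<kappa> x w \<kappa>' + b *\<^sub>R tangent_vec A \<kappa> x w' \<kappa>')"
proof
  fix \<kappa>'
  have "linear (frechet_derivative (transition \<kappa> \<kappa>') (at (snd \<kappa> x)))" if "\<kappa>' \<in> charts_at A x"
    using that by (intro has_derivative_linear[OF transition_has_derivative[OF assms(1,2) _ assms(3)]])
      (simp_all add: charts_at_def)
  then show "tangent_vec A \<kappa> x (a *\<^sub>R w + b *\<^sub>R w') \<kappa>' =
      a *\<^sub>R tangent_vec A \<kappa> x w \<kappa>' + b *\<^sub>R tangent_vec A \<kappa> x w' \<kappa>'"
    by (simp add: tangent_vec_def linear_add linear_cmul)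
qed

text \<open>The inverse of \<open>momenta\<close>: the covector with components
  \<open>\<rho>\<close> in \<open>\<kappa>\<close>. The value 0 off the tangent space matches the
  normalisation in \<open>cotangent_space\<close>, so that covectors with equal components are equal
  as functions.\<close>

definition covec ::
  "('e, 'n::finite E_coords) chart set \<Rightarrow> ('e, 'n E_coords) chart \<Rightarrow> 'e \<Rightarrow> real \<times> (real ^ 'n) \<Rightarrow>
   ('e, 'n E_coords) tvec \<Rightarrow> real" where
  "covec E \<kappa> e \<rho> = (\<lambda>X. if X \<in> tangent_space E e then \<rho> \<bullet> X \<kappa> else 0)"

lemma covec_in_cotangent_space:
  assumes "smooth_atlas E" "\<kappa> \<in> E" "e \<in> fst \<kappa>"
  shows "covec E \<kappa> e \<rho> \<in> cotangent_space E e"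
proof -
  have "(\<lambda>\<kappa>'. a *\<^sub>R X \<kappa>' + b *\<^sub>R Y \<kappa>') \<in> tangent_space E e"
    if "X \<in> tangent_space E e" "Y \<in> tangent_space E e" for X Y a b
    using tangent_vec_in_tangent_space[OF assms, of "a *\<^sub>R X \<kappa> + b *\<^sub>R Y \<kappa>"]
    unfolding tangent_vec_combine[OF assms] tangent_vec_of_components[OF assms(2,3) that(1)]
      tangent_vec_of_components[OF assms(2,3) that(2)] .
  then show ?thesis
    unfolding cotangent_space_def mem_Collect_eq
    by (intro conjI allI ballI impI) (simp_all add: covec_def inner_add_right)
qed

lemma momenta_covec:
  assumes "smooth_atlas E" "\<kappa> \<in> E" "e \<in> fst \<kappa>"
  shows "momenta E \<kappa> (e, covec E \<kappa> e \<rho>) = \<rho>"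
  by (cases \<rho>)
    (simp add: momenta_def covec_def tangent_vec_in_tangent_space[OF assms] tangent_vec_self[OF assms]
      inner_axis vec_eq_iff)

text \<open>On the tangent space a covector is determined by its values on the coordinate vectors,
  by linearity; off it both sides are 0.\<close>

lemma covec_momenta:
  assumes E: "smooth_atlas E" "\<kappa> \<in> E" "e \<in> fst \<kappa>" and \<alpha>: "\<alpha> \<in> cotangent_space E e"
  shows "covec E \<kappa> e (momenta E \<kappa> (e, \<alpha>)) = \<alpha>"
proof
  fix X
  define l where "l w = \<alpha> (tangent_vec E \<kappa> e w)" for w
  have l2: "l (a *\<^sub>R w + b *\<^sub>R w') = a * l w + b * l w'" for a b w w'
    using \<alpha> tangent_vec_in_tangent_space[OF E]
    by (simp add: l_def cotangent_space_def tangent_vec_combine[OF E])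
  have "linear l"
    using l2[of 1 _ 1] l2[of _ _ 0 0] by (intro linearI) simp_all
  have expand: "l (x, y) = x * l (1, 0) + (\<Sum>i\<in>UNIV. y $ i * l (0, axis i 1))" for x y
  proof -
    have "(x, y) = x *\<^sub>R (1, 0) + (\<Sum>i\<in>UNIV. y $ i *\<^sub>R (0, axis i 1))"
      using basis_expansion[of y] by (auto simp: prod_eq_iff fst_sum snd_sum scalar_mult_eq_scaleR)
    then show ?thesis
      using \<open>linear l\<close> by (simp only: linear_add linear_sum linear_cmul real_scaleR_def)
  qed
  have l: "momenta E \<kappa> (e, \<alpha>) \<bullet> w = l w" for w
    using expand[of "fst w" "snd w"] by (simp add: inner_prod_def momenta_def l_def[symmetric] inner_vec_def mult.commute)
  show "covec E \<kappa> e (momenta E \<kappa> (e, \<alpha>)) X = \<alpha> X"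
  proof (cases "X \<in> tangent_space E e")
    case True
    then show ?thesis
      by (simp add: covec_def l) (simp add: l_def tangent_vec_of_components[OF E(2,3)])
  next
    case False
    then show ?thesis using \<alpha> by (simp add: covec_def cotangent_space_def)
  qed
qed

text \<open>The coordinate vectors of \<open>\<kappa>'\<close> have the columns of the Jacobian
  \<open>D\<close> as their components in \<open>\<kappa>\<close>. The new momenta are thus linear
  in \<open>\<rho>\<close>, and their smoothness reduces to that of \<open>D\<close>.\<close>

lemma momenta_change_chart:
  assumes E: "smooth_atlas E" "\<kappa> \<in> E" "\<kappa>' \<in> E" "e \<in> fst \<kappa>" "e \<in> fst \<kappa>'"
  defines "D \<equiv> frechet_derivative (transition \<kappa>' \<kappa>) (at (snd \<kappa>' e))"
  shows "momenta E \<kappa>' (e, covec E \<kappa> e \<rho>) = (\<rho> \<bullet> D (1, 0), \<chi> i. \<rho> \<bullet> D (0, axis i 1))"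
  by (simp add: momenta_def tangent_vec_change_chart[OF E] covec_def
      tangent_vec_in_tangent_space[OF E(1,2,4)] tangent_vec_self[OF E(1,2,4)] D_def)

text \<open>The section picked by \<open>SOME\<close> is harmless, since all members of a jet share
  one velocity at the base time. The time component is 1 because a section satisfies
  \<open>\<pi> (\<phi> s) = s\<close> and the first coordinate of an adapted chart is
  \<open>\<pi>\<close>.\<close>

lemma jet_velocity:
  assumes E: "smooth_atlas E" and j: "j \<in> J1 E \<pi>" and \<kappa>: "\<kappa> \<in> adapted_charts E \<pi>" "fst j \<in> fst \<kappa>"
  shows "jet_velocity E \<pi> j \<in> tangent_space E (fst j)" "fst (jet_velocity E \<pi> j \<kappa>) = 1"
proof -
  obtain t \<phi> where j_eq: "j = jet_of E \<pi> t \<phi>" and \<phi>: "local_section E \<pi> t \<phi>"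
    using j by (auto simp: J1_def)
  obtain I where I: "open I" "t \<in> I" "\<And>s. s \<in> I \<Longrightarrow> smooth_at real_line E \<phi> s"
    "\<And>s. s \<in> I \<Longrightarrow> \<pi> (\<phi> s) = s"
    using \<phi> by (auto simp: local_section_def)
  have "\<phi> \<in> snd j" using \<phi> by (simp add: j_eq jet_of_def)
  then have "(SOME \<phi>. \<phi> \<in> snd j) \<in> snd j" by (rule someI[of "\<lambda>\<phi>. \<phi> \<in> snd j"])
  then have vel: "jet_velocity E \<pi> j = velocity E \<phi> t"
    using I(2,4) by (simp add: jet_velocity_def j_eq jet_of_def)
  have fst_j: "fst j = \<phi> t" by (simp add: j_eq jet_of_def)
  have \<phi>_t: "smooth_at real_line E \<phi> t" using I by blast
  show "jet_velocity E \<pi> j \<in> tangent_space E (fst j)"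
    unfolding vel fst_j by (rule velocity_in_tangent_space[OF E \<phi>_t])
  have \<kappa>E: "\<kappa> \<in> E" "\<phi> t \<in> fst \<kappa>" "\<And>x. x \<in> fst \<kappa> \<Longrightarrow> fst (snd \<kappa> x) = \<pi> x"
    using \<kappa> by (auto simp: adapted_charts_def fst_j)
  obtain N where N: "open N" "t \<in> N" "\<And>s. s \<in> N \<Longrightarrow> \<phi> s \<in> fst \<kappa>"
    by (rule smooth_at_real_lineE[OF E \<phi>_t \<kappa>E(1,2)]) (rule that)
  have "((\<lambda>s. fst (snd \<kappa> (\<phi> s))) has_vector_derivative fst (velocity E \<phi> t \<kappa>)) (at t)"
    by (rule has_vector_derivative_compose[OF smooth_at_real_line_differentiable[OF E \<phi>_t \<kappa>E(1,2)]])
      (rule bounded_linear_imp_has_derivative[OF bounded_linear_fst])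
  then have "((\<lambda>s. s) has_vector_derivative fst (velocity E \<phi> t \<kappa>)) (at t)"
    by (rule has_vector_derivative_transform_within_open[of _ _ _ "N \<inter> I"])
      (use N I \<kappa>E(3) in auto)
  from vector_derivative_unique_at[OF this has_vector_derivative_id]
  show "fst (jet_velocity E \<pi> j \<kappa>) = 1" by (simp add: vel)
qed

section \<open>The atlas of \<open>C \<times>\<^sub>E J\<^sup>1\<pi> \<times>\<^sub>E T\<^sup>*E\<close>\<close>

text \<open>The inverse of a chart of the ambient space of \<open>W0\<close> in its momentum
  variables: it places the covector with components \<open>\<rho>\<close> over the base point of
  \<open>x\<close>.\<close>

definition W_of ::
  "('e, 'n::finite E_coords) chart set \<Rightarrow> ('c \<Rightarrow> 'e) \<Rightarrow> ('e, 'n E_coords) chart \<Rightarrow>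
   'c \<times> 'e jet \<Rightarrow> real \<times> (real ^ 'n) \<Rightarrow> ('e, 'c, 'n) W_point" where
  "W_of E \<pi>C \<kappa> x \<rho> = (x, (\<pi>C (fst x), covec E \<kappa> (\<pi>C (fst x)) \<rho>))"

lemma CJ_chart_base:
  assumes "\<mu> \<in> adapted_control_charts C \<pi>C \<kappa>" "x \<in> fst (CJ_chart E \<pi> C \<pi>C \<kappa> \<mu>)"
  shows "\<pi>C (fst x) \<in> fst \<kappa>" "fst (fst (snd (CJ_chart E \<pi> C \<pi>C \<kappa> \<mu>) x)) = snd \<kappa> (\<pi>C (fst x))"
    "snd x \<in> J1 E \<pi>" "fst (snd x) = \<pi>C (fst x)"
  using assms by (auto simp: CJ_chart_def CJ_def adapted_control_charts_def)

lemma W_of_in_chart: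
  assumes "smooth_atlas E" "\<kappa> \<in> E" "\<mu> \<in> adapted_control_charts C \<pi>C \<kappa>"
    and x: "x \<in> fst (CJ_chart E \<pi> C \<pi>C \<kappa> \<mu>)"
  shows "W_of E \<pi>C \<kappa> x \<rho> \<in> fst (W_chart E \<pi> C \<pi>C \<kappa> \<mu>)"
    "snd (W_chart E \<pi> C \<pi>C \<kappa> \<mu>) (W_of E \<pi>C \<kappa> x \<rho>) = (snd (CJ_chart E \<pi> C \<pi>C \<kappa> \<mu>) x, \<rho>)"
  using assms CJ_chart_base[OF assms(3) x]
  by (auto simp: W_of_def W_chart_def cotangent_bundle_def covec_in_cotangent_space momenta_covec carrier_def)

lemma W_chart_point:
  assumes "smooth_atlas E" "\<kappa> \<in> E" "\<mu> \<in> adapted_control_charts C \<pi>C \<kappa>"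
    and w: "w \<in> fst (W_chart E \<pi> C \<pi>C \<kappa> \<mu>)"
  obtains x \<rho> where "w = W_of E \<pi>C \<kappa> x \<rho>" "x \<in> fst (CJ_chart E \<pi> C \<pi>C \<kappa> \<mu>)"
proof (rule that[of "fst w" "momenta E \<kappa> (snd w)"])
  show x: "fst w \<in> fst (CJ_chart E \<pi> C \<pi>C \<kappa> \<mu>)" using w by (auto simp: W_chart_def)
  show "w = W_of E \<pi>C \<kappa> (fst w) (momenta E \<kappa> (snd w))"
    using w CJ_chart_base(1)[OF assms(3) x] assms(1,2)
    by (auto simp: W_chart_def W_of_def cotangent_bundle_def covec_momenta)
qed

lemma W_of_in_chart_iff:
  assumes "smooth_atlas E" "\<kappa> \<in> E" "\<mu> \<in> adapted_control_charts C \<pi>C \<kappa>"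
    and x: "x \<in> fst (CJ_chart E \<pi> C \<pi>C \<kappa> \<mu>)"
  shows "W_of E \<pi>C \<kappa> x \<rho> \<in> fst (W_chart E \<pi> C \<pi>C \<kappa>' \<mu>') \<longleftrightarrow> x \<in> fst (CJ_chart E \<pi> C \<pi>C \<kappa>' \<mu>')"
  using W_of_in_chart(1)[OF assms, of \<rho>] by (auto simp: W_chart_def W_of_def)

text \<open>Being in a chart restricts only the point of the first factor, so every overlap has the
  form \<open>?O \<times> UNIV\<close>. There the transition is the one of the first factor together
  with the linear change of the momenta.\<close>

lemma smooth_atlas_W_atlas:
  fixes E :: "('e, 'n::finite E_coords) chart set" and C :: "('c, ('n, 'm::finite) C_coords) chart set"
  assumes E: "smooth_atlas E" and CJ: "smooth_atlas (CJ_atlas E \<pi> C \<pi>C)"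
  shows "smooth_atlas (W_atlas E \<pi> C \<pi>C)"
proof -
  have overlap: "inj_on (snd (W_chart E \<pi> C \<pi>C \<kappa> \<mu>)) (fst (W_chart E \<pi> C \<pi>C \<kappa> \<mu>)) \<and>
      open (snd (W_chart E \<pi> C \<pi>C \<kappa> \<mu>) `
        (fst (W_chart E \<pi> C \<pi>C \<kappa> \<mu>) \<inter> fst (W_chart E \<pi> C \<pi>C \<kappa>' \<mu>'))) \<and>
      smooth_on (snd (W_chart E \<pi> C \<pi>C \<kappa> \<mu>) `
        (fst (W_chart E \<pi> C \<pi>C \<kappa> \<mu>) \<inter> fst (W_chart E \<pi> C \<pi>C \<kappa>' \<mu>')))
        (transition (W_chart E \<pi> C \<pi>C \<kappa> \<mu>) (W_chart E \<pi> C \<pi>C \<kappa>' \<mu>'))"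
    if \<kappa>: "\<kappa> \<in> adapted_charts E \<pi>" "\<mu> \<in> adapted_control_charts C \<pi>C \<kappa>"
      and \<kappa>': "\<kappa>' \<in> adapted_charts E \<pi>" "\<mu>' \<in> adapted_control_charts C \<pi>C \<kappa>'" for \<kappa> \<mu> \<kappa>' \<mu>'
  proof -
    let ?W = "W_chart E \<pi> C \<pi>C \<kappa> \<mu>" and ?W' = "W_chart E \<pi> C \<pi>C \<kappa>' \<mu>'"
    let ?X = "CJ_chart E \<pi> C \<pi>C \<kappa> \<mu>" and ?X' = "CJ_chart E \<pi> C \<pi>C \<kappa>' \<mu>'"
    have \<kappa>E: "\<kappa> \<in> E" "\<kappa>' \<in> E" using \<kappa>(1) \<kappa>'(1) by (auto simp: adapted_charts_def)
    have XA: "?X \<in> CJ_atlas E \<pi> C \<pi>C" "?X' \<in> CJ_atlas E \<pi> C \<pi>C"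
      unfolding CJ_atlas_def using \<kappa> \<kappa>' by blast+
    note injX = smooth_atlas_chart(1)[OF CJ XA(1)]
    note point = W_chart_point[OF E \<kappa>E(1) \<kappa>(2)]
    note of_chart = W_of_in_chart[OF E \<kappa>E(1) \<kappa>(2)]
    note of_chart_iff = W_of_in_chart_iff[OF E \<kappa>E(1) \<kappa>(2)]
    have injW: "inj_on (snd ?W) (fst ?W)"
    proof (rule inj_onI)
      fix w w' assume w: "w \<in> fst ?W" "w' \<in> fst ?W" "snd ?W w = snd ?W w'"
      obtain x \<rho> where x: "w = W_of E \<pi>C \<kappa> x \<rho>" "x \<in> fst ?X" by (rule point[OF w(1)])
      obtain x' \<rho>' where x': "w' = W_of E \<pi>C \<kappa> x' \<rho>'" "x' \<in> fst ?X" by (rule point[OF w(2)])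
      show "w = w'"
        using w(3) x x' of_chart(2)[OF x(2)] of_chart(2)[OF x'(2)] injX by (simp add: inj_on_eq_iff)
    qed
    let ?O = "snd ?X ` (fst ?X \<inter> fst ?X')"
    have image: "snd ?W ` (fst ?W \<inter> fst ?W') = ?O \<times> UNIV"
    proof (intro equalityI subsetI)
      fix y assume "y \<in> snd ?W ` (fst ?W \<inter> fst ?W')"
      then obtain w where w: "w \<in> fst ?W" "w \<in> fst ?W'" "y = snd ?W w" by blast
      obtain x \<rho> where x: "w = W_of E \<pi>C \<kappa> x \<rho>" "x \<in> fst ?X" by (rule point[OF w(1)])
      show "y \<in> ?O \<times> UNIV"
        using w x of_chart(2)[OF x(2)] of_chart_iff[OF x(2)] by auto
    next
      fix y assume "y \<in> ?O \<times> (UNIV :: (real \<times> (real ^ 'n)) set)"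
      then obtain x \<rho> where y: "y = (snd ?X x, \<rho>)" and x: "x \<in> fst ?X" "x \<in> fst ?X'" by auto
      show "y \<in> snd ?W ` (fst ?W \<inter> fst ?W')"
        using of_chart[OF x(1)] of_chart_iff[OF x(1)] x(2) y
        by (intro image_eqI[of _ _ "W_of E \<pi>C \<kappa> x \<rho>"]) auto
    qed
    have "open ?O" by (rule smooth_atlas_overlap(1)[OF CJ XA])
    then have opn: "open (?O \<times> (UNIV :: (real \<times> (real ^ 'n)) set))" by (intro open_Times) auto
    \<comment> \<open>\<open>fst (fst (fst y))\<close> is the pair \<open>(t, q)\<close> of the base
      point in \<open>\<kappa>\<close>. Momenta change by the Jacobian of the transition back from
      \<open>\<kappa>'\<close> to \<open>\<kappa>\<close>, which has to be taken at the
      \<open>\<kappa>'\<close>-coordinates of that point.\<close>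
    define D where "D y b = frechet_derivative (transition \<kappa>' \<kappa>) (at (transition \<kappa> \<kappa>' (fst (fst (fst y))))) b"
      for y :: "('n, 'm) W_coords" and b
    define T where "T y = (transition ?X ?X' (fst y), (snd y \<bullet> D y (1, 0), \<chi> i. snd y \<bullet> D y (0, axis i 1)))"
      for y
    have T: "transition ?W ?W' y = T y" if y: "y \<in> ?O \<times> UNIV" for y
    proof -
      obtain x \<rho> where y: "y = (snd ?X x, \<rho>)" and x: "x \<in> fst ?X" "x \<in> fst ?X'" using y by auto
      have e: "\<pi>C (fst x) \<in> fst \<kappa>" "\<pi>C (fst x) \<in> fst \<kappa>'" "fst (fst (snd ?X x)) = snd \<kappa> (\<pi>C (fst x))"
        using CJ_chart_base[OF \<kappa>(2) x(1)] CJ_chart_base[OF \<kappa>'(2) x(2)] by auto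
      have "transition ?W ?W' y = snd ?W' (W_of E \<pi>C \<kappa> x \<rho>)"
        using transition_apply[OF injW of_chart(1)[OF x(1)]] of_chart(2)[OF x(1)] by (metis y)
      also have "\<dots> = (snd ?X' x, momenta E \<kappa>' (\<pi>C (fst x), covec E \<kappa> (\<pi>C (fst x)) \<rho>))"
        by (simp add: W_chart_def W_of_def)
      also have "\<dots> = T y"
        using e transition_apply[OF injX x(1)] transition_apply[OF smooth_atlas_chart(1)[OF E \<kappa>E(1)] e(1)]
        by (simp add: T_def D_def y momenta_change_chart[OF E \<kappa>E e(1,2)])
      finally show ?thesis .
    qed
    have smooth_D: "smooth_on (?O \<times> UNIV) (\<lambda>y. D y b)" for b
    proof -
      have base: "fst (fst (fst y)) \<in> snd \<kappa> ` (fst \<kappa> \<inter> fst \<kappa>')" if "y \<in> ?O \<times> UNIV"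
        for y :: "('n, 'm) W_coords"
        using that CJ_chart_base[OF \<kappa>(2), of _ E \<pi>] CJ_chart_base[OF \<kappa>'(2), of _ E \<pi>] by fastforce
      have "smooth_on (?O \<times> UNIV) (\<lambda>y :: ('n, 'm) W_coords. fst (fst (fst y)))"
        by (intro smooth_on_linear opn) (intro bounded_linear_fst_comp bounded_linear_fst)
      then have "smooth_on (?O \<times> UNIV) (\<lambda>y :: ('n, 'm) W_coords. transition \<kappa> \<kappa>' (fst (fst (fst y))))"
        by (rule smooth_on_compose[OF smooth_atlas_overlap(2)[OF E \<kappa>E] _ opn]) (use base in blast)
      moreover have "(\<lambda>y :: ('n, 'm) W_coords. transition \<kappa> \<kappa>' (fst (fst (fst y)))) ` (?O \<times> UNIV) \<subseteq>
          snd \<kappa>' ` (fst \<kappa>' \<inter> fst \<kappa>)"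
      proof (rule image_subsetI)
        fix y :: "('n, 'm) W_coords" assume "y \<in> ?O \<times> UNIV"
        then obtain e where "fst (fst (fst y)) = snd \<kappa> e" "e \<in> fst \<kappa>" "e \<in> fst \<kappa>'"
          using base[of y] by blast
        then show "transition \<kappa> \<kappa>' (fst (fst (fst y))) \<in> snd \<kappa>' ` (fst \<kappa>' \<inter> fst \<kappa>)"
          by (simp add: transition_apply[OF smooth_atlas_chart(1)[OF E \<kappa>E(1)]])
      qed
      ultimately show ?thesis
        unfolding D_def
        by (rule smooth_on_compose[OF smooth_on_frechet_derivative[OF smooth_atlas_overlap(2)[OF E \<kappa>E(2,1)]] _ opn])
    qed
    have "smooth_on (?O \<times> UNIV) T"
      unfolding T_def
    proof (intro smooth_on_Pair smooth_on_vec_lambda smooth_on_bilinear[OF bounded_bilinear_inner] opn smooth_D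
        smooth_on_linear[OF bounded_linear_snd opn])
      show "smooth_on (?O \<times> UNIV) (\<lambda>y :: ('n, 'm) W_coords. transition ?X ?X' (fst y))"
        by (rule smooth_on_compose[where f=fst and T="?O"])
          (auto intro: smooth_atlas_overlap(2)[OF CJ XA] smooth_on_linear[OF bounded_linear_fst opn] opn)
    qed
    then have "smooth_on (?O \<times> UNIV) (transition ?W ?W')"
      by (rule smooth_on_cong[OF opn, THEN iffD1, rotated]) (simp add: T)
    with injW opn show ?thesis by (simp add: image)
  qed
  show ?thesis
    unfolding smooth_atlas_def
  proof (intro conjI ballI)
    fix \<nu> \<nu>' assume "\<nu> \<in> W_atlas E \<pi> C \<pi>C"
    then obtain \<kappa> \<mu> where \<nu>: "\<nu> = W_chart E \<pi> C \<pi>C \<kappa> \<mu>" "\<kappa> \<in> adapted_charts E \<pi>"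
      "\<mu> \<in> adapted_control_charts C \<pi>C \<kappa>"
      unfolding W_atlas_def by blast
    note overlap[OF \<nu>(2,3,2,3), folded \<nu>(1)]
    then show "inj_on (snd \<nu>) (fst \<nu>)" "open (snd \<nu> ` fst \<nu>)" by simp_all
    assume "\<nu>' \<in> W_atlas E \<pi> C \<pi>C"
    then obtain \<kappa>' \<mu>' where \<nu>': "\<nu>' = W_chart E \<pi> C \<pi>C \<kappa>' \<mu>'" "\<kappa>' \<in> adapted_charts E \<pi>"
      "\<mu>' \<in> adapted_control_charts C \<pi>C \<kappa>'"
      unfolding W_atlas_def by blast
    note overlap[OF \<nu>(2,3) \<nu>'(2,3), folded \<nu>(1) \<nu>'(1)]
    then show "open (snd \<nu> ` (fst \<nu> \<inter> fst \<nu>'))"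
      and "smooth_on (snd \<nu> ` (fst \<nu> \<inter> fst \<nu>')) (transition \<nu> \<nu>')" by simp_all
  qed
qed

text \<open>In an adapted chart the velocity of a jet is \<open>(1, v)\<close>, so the covector with
  components \<open>(p, r)\<close> takes on it the value \<open>p + r \<bullet> v\<close>.\<close>

lemma W_of_in_W0_iff:
  assumes E: "smooth_atlas E" "\<kappa> \<in> adapted_charts E \<pi>" and \<mu>: "\<mu> \<in> adapted_control_charts C \<pi>C \<kappa>"
    and x: "x \<in> fst (CJ_chart E \<pi> C \<pi>C \<kappa> \<mu>)"
  shows "W_of E \<pi>C \<kappa> x \<rho> \<in> W0 E \<pi> \<pi>C L M \<longleftrightarrow>
    x \<in> M \<and> fst \<rho> + snd \<rho> \<bullet> snd (snd (CJ_chart E \<pi> C \<pi>C \<kappa> \<mu>) x) = L x"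
proof -
  note base = CJ_chart_base[OF \<mu> x]
  have "\<kappa> \<in> E" using E(2) by (simp add: adapted_charts_def)
  then have "(\<pi>C (fst x), covec E \<kappa> (\<pi>C (fst x)) \<rho>) \<in> cotangent_bundle E"
    using W_of_in_chart(1)[OF E(1) _ \<mu> x] by (auto simp: W_of_def W_chart_def)
  moreover have "jet_velocity E \<pi> (snd x) \<kappa> = (1, snd (snd (CJ_chart E \<pi> C \<pi>C \<kappa> \<mu>) x))"
    using jet_velocity(2)[OF E(1) base(3) E(2)] base(1,4)
    by (simp add: CJ_chart_def case_prod_beta prod_eq_iff)
  moreover have "jet_velocity E \<pi> (snd x) \<in> tangent_space E (\<pi>C (fst x))"
    using jet_velocity(1)[OF E(1) base(3) E(2)] base(1,4) by simp
  ultimately show ?thesis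
    by (auto simp: W_of_def W0_def WM_def covec_def inner_prod_def)
qed

section \<open>Tangent vectors of \<open>W0\<close> and the equations of motion\<close>

text \<open>The curve \<open>y\<close> in \<open>M\<close> realises \<open>h\<close>, and the
  momenta \<open>p_i\<close> follow the straight line with direction \<open>r'\<close>. Solving the
  equation of \<open>W0\<close> for \<open>p\<close> then keeps the lifted curve in
  \<open>W0\<close> and fixes the remaining velocity component.\<close>

lemma W0_curve:
  fixes E :: "('e, 'n::finite E_coords) chart set" and C :: "('c, ('n, 'm::finite) C_coords) chart set"
    and \<pi> :: "'e \<Rightarrow> real" and \<pi>C :: "'c \<Rightarrow> 'e"
    and \<kappa> :: "('e, 'n E_coords) chart" and \<mu> :: "('c, ('n, 'm) C_coords) chart"
    and \<Psi> :: "'s::finite \<Rightarrow> ('n, 'm) CJ_coords \<Rightarrow> real" and \<L> :: "('n, 'm) C_coords \<Rightarrow> real"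
  defines "X \<equiv> CJ_chart E \<pi> C \<pi>C \<kappa> \<mu>"
  assumes E: "smooth_atlas E" and sub: "submanifold (CJ_atlas E \<pi> C \<pi>C) M"
    and \<kappa>: "\<kappa> \<in> adapted_charts E \<pi>" and \<mu>: "\<mu> \<in> adapted_control_charts C \<pi>C \<kappa>"
    and D: "open D" "D \<subseteq> snd X ` fst X"
    and \<Psi>: "\<And>\<alpha>. smooth_on D (\<Psi> \<alpha>)"
    and M_eq: "\<And>x. x \<in> fst X \<Longrightarrow> snd X x \<in> D \<Longrightarrow> x \<in> M \<longleftrightarrow> (\<forall>\<alpha>. \<Psi> \<alpha> (snd X x) = 0)"
    and indep: "\<And>z. z \<in> D \<Longrightarrow> (\<forall>\<alpha>. \<Psi> \<alpha> z = 0) \<Longrightarrow>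
      wedge (\<lambda>\<alpha>. frechet_derivative (\<Psi> \<alpha>) (at z)) \<noteq> (\<lambda>_. 0)"
    and \<L>: "smooth_on (fst ` D) \<L>"
    and L_eq: "\<And>x. x \<in> M \<Longrightarrow> x \<in> fst X \<Longrightarrow> snd X x \<in> D \<Longrightarrow> L x = \<L> (fst (snd X x))"
    and w: "w \<in> W0 E \<pi> \<pi>C L M" "w \<in> fst (W_chart E \<pi> C \<pi>C \<kappa> \<mu>)"
      "snd (W_chart E \<pi> C \<pi>C \<kappa> \<mu>) w = (z, (p, r))" "z \<in> D"
    and h: "\<And>\<alpha>. frechet_derivative (\<Psi> \<alpha>) (at z) h = 0"
  obtains c I where "open I" "0 \<in> I" "c 0 = w"
    "\<And>s. s \<in> I \<Longrightarrow> smooth_at real_line (W_atlas E \<pi> C \<pi>C) c s"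
    "\<And>s. s \<in> I \<Longrightarrow> c s \<in> W0 E \<pi> \<pi>C L M"
    "velocity (W_atlas E \<pi> C \<pi>C) c 0 (W_chart E \<pi> C \<pi>C \<kappa> \<mu>) =
      (h, (frechet_derivative \<L> (at (fst z)) (fst h) - r' \<bullet> snd z - r \<bullet> snd h, r'))"
proof -
  let ?W = "W_chart E \<pi> C \<pi>C \<kappa> \<mu>" and ?A = "CJ_atlas E \<pi> C \<pi>C"
  have \<kappa>E: "\<kappa> \<in> E" using \<kappa> by (simp add: adapted_charts_def)
  have XA: "X \<in> ?A" unfolding CJ_atlas_def X_def using \<kappa> \<mu> by blast
  have WA: "?W \<in> W_atlas E \<pi> C \<pi>C" unfolding W_atlas_def using \<kappa> \<mu> by blast
  note of_chart = W_of_in_chart[OF E \<kappa>E \<mu>, where \<pi>=\<pi>, folded X_def]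
  note in_W0 = W_of_in_W0_iff[OF E \<kappa> \<mu>, folded X_def]
  obtain x \<rho> where w_eq: "w = W_of E \<pi>C \<kappa> x \<rho>" and x: "x \<in> fst X"
    unfolding X_def by (rule W_chart_point[OF E \<kappa>E \<mu> w(2)])
  have z: "snd X x = z" and \<rho>: "\<rho> = (p, r)" using of_chart(2)[OF x, of \<rho>] w(3) by (simp_all add: w_eq)
  have xM: "x \<in> M" and p: "p + r \<bullet> snd z = L x"
    using w(1) in_W0[OF x] by (auto simp: w_eq z \<rho>)
  have CJ: "smooth_atlas ?A" by (rule submanifold_smooth_atlas[OF sub xM])
  have zero: "\<Psi> \<alpha> z = 0" for \<alpha> using M_eq[OF x] xM w(4) by (simp add: z)
  obtain c0 where c0: "c0 0 = z" "(c0 has_vector_derivative h) (at 0)"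
    "\<forall>\<^sub>F s in nhds 0. c0 s \<in> D \<and> (\<forall>\<alpha>. \<Psi> \<alpha> (c0 s) = 0)"
    by (rule curve_in_level_set[OF D(1) w(4) \<Psi> zero indep[OF w(4)] h]) (simp add: zero)
  have near: "\<forall>\<^sub>F s in nhds 0. c0 s \<in> snd X ` (M \<inter> fst X)"
    using c0(3)
  proof eventually_elim
    case (elim s)
    then obtain y where "y \<in> fst X" "c0 s = snd X y" using D(2) by blast
    then show ?case using M_eq[of y] elim by auto
  qed
  obtain y I0 where I0: "open I0" "0 \<in> I0" and y0: "y 0 = x"
    and yM: "\<And>s. s \<in> I0 \<Longrightarrow> y s \<in> M" and yX: "\<And>s. s \<in> I0 \<Longrightarrow> y s \<in> fst X"
    and smooth0: "smooth_on I0 (\<lambda>s. snd X (y s))"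
    and vel: "((\<lambda>s. snd X (y s)) has_vector_derivative h) (at 0)"
    by (rule submanifold_smooth_curve[OF XA sub xM x _ c0(2) near]) (simp add: c0(1) z, rule that)
  define \<zeta> where "\<zeta> s = snd X (y s)" for s
  \<comment> \<open>Shrinking to \<open>D\<close> keeps the curve where the coordinate formula
    \<open>\<L>\<close> for the cost is available.\<close>
  define I where "I = I0 \<inter> \<zeta> -` D"
  have \<zeta>0: "\<zeta> 0 = z" by (simp add: \<zeta>_def y0 z)
  have I: "open I" "0 \<in> I"
    unfolding I_def
    using continuous_open_preimage[OF smooth_on_imp_continuous_on[OF smooth0] I0(1) D(1)] I0(2) \<zeta>0 w(4)
    by (simp_all add: \<zeta>_def[abs_def])
  have \<zeta>: "smooth_on I \<zeta>" unfolding \<zeta>_def[abs_def] by (rule smooth_on_subset[OF smooth0]) (simp add: I_def)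
  define R where "R s = r + s *\<^sub>R r'" for s
  \<comment> \<open>This is \<open>p = L - p_i v^i\<close> along the curve, with the minus sign
    moved into the inner product so that the sum and product rules apply directly.\<close>
  define P where "P s = \<L> (fst (\<zeta> s)) + (- R s) \<bullet> snd (\<zeta> s)" for s
  define c where "c s = W_of E \<pi>C \<kappa> (y s) (P s, R s)" for s
  have cW: "c s \<in> fst ?W" "snd ?W (c s) = (\<zeta> s, (P s, R s))" if "s \<in> I" for s
    using of_chart[OF yX[of s]] that by (auto simp: c_def \<zeta>_def I_def)
  have c_W0: "c s \<in> W0 E \<pi> \<pi>C L M" if "s \<in> I" for s
    using that in_W0[OF yX[of s]] yM[of s] L_eq[of "y s"] yX[of s]
    by (auto simp: c_def \<zeta>_def I_def P_def)
  have R: "smooth_on I R"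
    unfolding R_def[abs_def] by (intro smooth_on_add smooth_on_const smooth_on_linear I bounded_linear_scaleR_left)
  have "smooth_on I (\<lambda>s. fst (\<zeta> s))" by (rule smooth_on_bounded_linear[OF bounded_linear_fst I(1) \<zeta>])
  then have "smooth_on I (\<lambda>s. \<L> (fst (\<zeta> s)))"
    by (rule smooth_on_compose[OF \<L> _ I(1)]) (auto simp: I_def)
  moreover have "smooth_on I (\<lambda>s. (- R s) \<bullet> snd (\<zeta> s))"
    by (intro smooth_on_bilinear[OF bounded_bilinear_inner] I
      smooth_on_bounded_linear[OF bounded_linear_minus[OF bounded_linear_ident] I(1) R]
      smooth_on_bounded_linear[OF bounded_linear_snd I(1) \<zeta>])
  ultimately have P: "smooth_on I P" unfolding P_def[abs_def] by (rule smooth_on_add[OF I(1)])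
  have smooth: "smooth_on I (\<lambda>s. snd ?W (c s))"
    by (rule smooth_on_cong[OF I(1), THEN iffD1, OF _ smooth_on_Pair[OF I(1) \<zeta> smooth_on_Pair[OF I(1) P R]]])
      (simp add: cW)
  have smooth_c: "smooth_at real_line (W_atlas E \<pi> C \<pi>C) c s" if "s \<in> I" for s
    by (rule smooth_at_real_lineI[OF WA I(1) that cW(1) smooth])
  let ?d\<L> = "frechet_derivative \<L> (at (fst z))"
  have d\<L>: "(\<L> has_derivative ?d\<L>) (at (fst (\<zeta> 0)))"
    unfolding \<zeta>0 by (rule smooth_on_has_derivative[OF \<L>]) (use w(4) in auto)
  have d\<zeta>: "(\<zeta> has_vector_derivative h) (at 0)" using vel by (simp add: \<zeta>_def[abs_def])
  have d1: "((\<lambda>s. fst (\<zeta> s)) has_vector_derivative fst h) (at 0)"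
    by (rule has_vector_derivative_compose[OF d\<zeta> bounded_linear_imp_has_derivative[OF bounded_linear_fst]])
  have d2: "((\<lambda>s. snd (\<zeta> s)) has_vector_derivative snd h) (at 0)"
    by (rule has_vector_derivative_compose[OF d\<zeta> bounded_linear_imp_has_derivative[OF bounded_linear_snd]])
  have dR: "(R has_vector_derivative r') (at 0)"
    unfolding R_def[abs_def] by (auto intro!: derivative_eq_intros)
  have dR': "((\<lambda>s. - R s) has_vector_derivative - r') (at 0)"
    using dR by (rule has_vector_derivative_minus)
  have "((\<lambda>s. (- R s) \<bullet> snd (\<zeta> s)) has_vector_derivative (- R 0) \<bullet> snd h + (- r') \<bullet> snd (\<zeta> 0)) (at 0)"
    by (rule bounded_bilinear.has_vector_derivative[OF bounded_bilinear_inner dR' d2])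
  from has_vector_derivative_add[OF has_vector_derivative_compose[OF d1 d\<L>] this]
  have dP: "(P has_vector_derivative ?d\<L> (fst h) - r' \<bullet> snd z - r \<bullet> snd h) (at 0)"
    by (simp add: P_def[abs_def] R_def \<zeta>0 algebra_simps)
  have "((\<lambda>s. (\<zeta> s, (P s, R s))) has_vector_derivative (h, (?d\<L> (fst h) - r' \<bullet> snd z - r \<bullet> snd h, r'))) (at 0)"
    by (intro has_vector_derivative_Pair d\<zeta> dP dR)
  then have "((\<lambda>s. snd ?W (c s)) has_vector_derivative
      (h, (?d\<L> (fst h) - r' \<bullet> snd z - r \<bullet> snd h, r'))) (at 0)"
    by (rule has_vector_derivative_transform_within_open[OF _ I]) (simp add: cW)
  from vector_derivative_unique_at[OF
      smooth_at_real_line_differentiable[OF smooth_atlas_W_atlas[OF E CJ] smooth_c[OF I(2)] WA cW(1)[OF I(2)]] this]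
  have "velocity (W_atlas E \<pi> C \<pi>C) c 0 ?W = (h, (?d\<L> (fst h) - r' \<bullet> snd z - r \<bullet> snd h, r'))" .
  moreover have "c 0 = w"
  proof -
    have "P 0 = p" using p L_eq[OF xM x] w(4) by (simp add: P_def R_def \<zeta>0 z)
    then show ?thesis by (simp add: c_def w_eq y0 \<rho> R_def)
  qed
  ultimately show ?thesis by (intro that[OF I _ smooth_c c_W0])
qed

text \<open>In corresponding charts the projection is the linear map that forgets \<open>u\<close>
  and \<open>v\<close>, so it acts on velocities by the same formula.\<close>

lemma tangent_map_to_cotangent_bundle:
  fixes E :: "('e, 'n::finite E_coords) chart set" and C :: "('c, ('n, 'm::finite) C_coords) chart set"
  assumes E: "\<kappa> \<in> adapted_charts E \<pi>" and \<mu>: "\<mu> \<in> adapted_control_charts C \<pi>C \<kappa>"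
    and W: "smooth_atlas (W_atlas E \<pi> C \<pi>C)" and c: "smooth_at real_line (W_atlas E \<pi> C \<pi>C) c t"
    and ct: "c t \<in> fst (W_chart E \<pi> C \<pi>C \<kappa> \<mu>)"
  defines "Y \<equiv> velocity (W_atlas E \<pi> C \<pi>C) c t"
  shows "T_chart E \<kappa> \<in> charts_at (T_atlas E \<pi>) (snd (c t))"
    and "tangent_map (W_atlas E \<pi> C \<pi>C) (T_atlas E \<pi>) snd (c t) Y (T_chart E \<kappa>) =
      (fst (fst (fst (Y (W_chart E \<pi> C \<pi>C \<kappa> \<mu>)))), snd (Y (W_chart E \<pi> C \<pi>C \<kappa> \<mu>)))"
proof -
  let ?W = "W_chart E \<pi> C \<pi>C \<kappa> \<mu>"
  have WA: "?W \<in> W_atlas E \<pi> C \<pi>C" unfolding W_atlas_def using E \<mu> by blast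
  have W_snd: "fst (snd w) = \<pi>C (fst (fst w))" "snd w \<in> cotangent_bundle E"
    "fst w \<in> fst (CJ_chart E \<pi> C \<pi>C \<kappa> \<mu>)"
    "snd ?W w = (snd (CJ_chart E \<pi> C \<pi>C \<kappa> \<mu>) (fst w), momenta E \<kappa> (snd w))" if "w \<in> fst ?W" for w
    using that by (auto simp: W_chart_def)
  show T: "T_chart E \<kappa> \<in> charts_at (T_atlas E \<pi>) (snd (c t))"
    using E W_snd[OF ct] CJ_chart_base(1)[OF \<mu> W_snd(3)[OF ct]]
    by (auto simp: charts_at_def T_atlas_def T_chart_def)
  have lin: "bounded_linear (\<lambda>y :: ('n, 'm) W_coords. (fst (fst (fst y)), snd y))"
    by (intro bounded_linear_Pair bounded_linear_fst_comp bounded_linear_fst bounded_linear_snd)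
  have "snd (T_chart E \<kappa>) (snd w) = (fst (fst (fst (snd ?W w))), snd (snd ?W w))" if "w \<in> fst ?W" for w
    using W_snd[OF that] CJ_chart_base(2)[OF \<mu> W_snd(3)[OF that]] by (simp add: T_chart_def)
  from tangent_map_velocity[OF W WA ct c T lin this]
  show "tangent_map (W_atlas E \<pi> C \<pi>C) (T_atlas E \<pi>) snd (c t) Y (T_chart E \<kappa>) =
      (fst (fst (fst (Y ?W))), snd (Y ?W))"
    unfolding Y_def .
qed

text \<open>\<open>deriv\<close> has some value even where no derivative exists, so
  differentiability is a conjunct of its own next to the differential equation. Likewise the first
  conjunct is what makes \<open>vector_derivative q\<close> a genuine derivative.\<close>

theorem mainTheorem3:
  fixes E :: "('e, 'n::finite E_coords) chart set"
    and F :: "('f, real ^ 'n) chart set"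
    and \<pi> :: "'e \<Rightarrow> real"
    and C :: "('c, ('n, 'm::finite) C_coords) chart set"
    and G :: "('g, real ^ 'm) chart set"
    and \<pi>C :: "'c \<Rightarrow> 'e"
    and L :: "'c \<times> 'e jet \<Rightarrow> real"
    and M :: "('c \<times> 'e jet) set"
    and \<kappa> :: "('e, 'n E_coords) chart"
    and \<mu> :: "('c, ('n, 'm) C_coords) chart"
    and D :: "('n, 'm) CJ_coords set"
    and \<Psi> :: "'s::finite \<Rightarrow> ('n, 'm) CJ_coords \<Rightarrow> real"
    and \<L> :: "('n, 'm) C_coords \<Rightarrow> real"
    and Z :: "('e, 'c, 'n) W_point \<Rightarrow> (('e, 'c, 'n) W_point, ('n, 'm) W_coords) tvec"
    and J :: "real set"
    and \<gamma> :: "real \<Rightarrow> ('e, 'c, 'n) W_point"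
    and q v p\<^sub>i :: "real \<Rightarrow> real ^ 'n" and u :: "real \<Rightarrow> real ^ 'm" and p :: "real \<Rightarrow> real"
  assumes bundles: "control_bundles E F \<pi> C G \<pi>C"
    and system: "implicit_optimal_control_system E \<pi> C \<pi>C L M"
    \<comment> \<open>the chart \<open>(t, q, u, v)\<close>, with image \<open>D\<close>\<close>
    and chart: "\<kappa> \<in> adapted_charts E \<pi>" "\<mu> \<in> adapted_control_charts C \<pi>C \<kappa>"
      "open D" "D \<subseteq> snd (CJ_chart E \<pi> C \<pi>C \<kappa> \<mu>) ` fst (CJ_chart E \<pi> C \<pi>C \<kappa> \<mu>)"
    and \<Psi>_smooth: "\<And>\<alpha>. smooth_on D (\<Psi> \<alpha>)"
    and M_eq: "\<And>x. x \<in> fst (CJ_chart E \<pi> C \<pi>C \<kappa> \<mu>) \<Longrightarrow> snd (CJ_chart E \<pi> C \<pi>C \<kappa> \<mu>) x \<in> D \<Longrightarrow>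
      x \<in> M \<longleftrightarrow> (\<forall>\<alpha>. \<Psi> \<alpha> (snd (CJ_chart E \<pi> C \<pi>C \<kappa> \<mu>) x) = 0)"
    and \<Psi>_indep: "\<And>z. z \<in> D \<Longrightarrow> (\<forall>\<alpha>. \<Psi> \<alpha> z = 0) \<Longrightarrow>
      wedge (\<lambda>\<alpha>. frechet_derivative (\<Psi> \<alpha>) (at z)) \<noteq> (\<lambda>_. 0)"
    and \<L>_smooth: "smooth_on (fst ` D) \<L>"
    and L_eq: "\<And>x. x \<in> M \<Longrightarrow> x \<in> fst (CJ_chart E \<pi> C \<pi>C \<kappa> \<mu>) \<Longrightarrow> snd (CJ_chart E \<pi> C \<pi>C \<kappa> \<mu>) x \<in> D \<Longrightarrow>
      L x = \<L> (fst (snd (CJ_chart E \<pi> C \<pi>C \<kappa> \<mu>) x))"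
    and Z: "vector_field_on (W_atlas E \<pi> C \<pi>C) (W0 E \<pi> \<pi>C L M) Z"
    and Z_\<Omega>: "contraction_vanishes E \<pi> C \<pi>C L M Z"
    and Z_dt: "\<And>w. w \<in> W0 E \<pi> \<pi>C L M \<Longrightarrow>
      differential (W_atlas E \<pi> C \<pi>C) (\<lambda>w. \<pi> (\<pi>C (fst (fst w)))) w (Z w) = 1"
    and J: "open J" "is_interval J"
    and \<gamma>: "integral_curve (W_atlas E \<pi> C \<pi>C) (W0 E \<pi> \<pi>C L M) Z J \<gamma>"
    and \<gamma>_coords: "\<And>t. t \<in> J \<Longrightarrow> \<gamma> t \<in> fst (W_chart E \<pi> C \<pi>C \<kappa> \<mu>) \<and>
      snd (W_chart E \<pi> C \<pi>C \<kappa> \<mu>) (\<gamma> t) = ((((t, q t), u t), v t), (p t, p\<^sub>i t)) \<and>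
      (((t, q t), u t), v t) \<in> D"
  shows "(\<forall>t\<in>J. (q has_vector_derivative v t) (at t)) \<and>
    (\<exists>\<Lambda> :: 's \<Rightarrow> real \<Rightarrow> real. \<forall>t\<in>J.
      (\<forall>i. (\<lambda>\<tau>. \<Sum>\<alpha>\<in>UNIV. \<Lambda> \<alpha> \<tau> *
               partial (\<Psi> \<alpha>) (((0, 0), 0), axis i 1) (((\<tau>, q \<tau>), u \<tau>), vector_derivative q (at \<tau>)))
             differentiable (at t) \<and>
           deriv (\<lambda>\<tau>. \<Sum>\<alpha>\<in>UNIV. \<Lambda> \<alpha> \<tau> *
               partial (\<Psi> \<alpha>) (((0, 0), 0), axis i 1) (((\<tau>, q \<tau>), u \<tau>), vector_derivative q (at \<tau>))) t
           + partial \<L> ((0, axis i 1), 0) ((t, q t), u t)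
           - (\<Sum>\<alpha>\<in>UNIV. \<Lambda> \<alpha> t *
               partial (\<Psi> \<alpha>) (((0, axis i 1), 0), 0) (((t, q t), u t), vector_derivative q (at t))) = 0) \<and>
      (\<forall>a. partial \<L> ((0, 0), axis a 1) ((t, q t), u t)
           - (\<Sum>\<alpha>\<in>UNIV. \<Lambda> \<alpha> t *
               partial (\<Psi> \<alpha>) (((0, 0), axis a 1), 0) (((t, q t), u t), vector_derivative q (at t))) = 0) \<and>
      (\<forall>\<alpha>. \<Psi> \<alpha> (((t, q t), u t), vector_derivative q (at t)) = 0))"
proof -
  let ?W = "W_chart E \<pi> C \<pi>C \<kappa> \<mu>" and ?WA = "W_atlas E \<pi> C \<pi>C" and ?S = "W0 E \<pi> \<pi>C L M"
  define z where "z t = (((t, q t), u t), v t)" for t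
  have E: "smooth_atlas E"
    using bundles by (simp add: control_bundles_def fibre_bundle_def smooth_manifold_def)
  have sub: "submanifold (CJ_atlas E \<pi> C \<pi>C) M"
    using system by (simp add: implicit_optimal_control_system_def)
  have WA: "?W \<in> ?WA" unfolding W_atlas_def using chart by blast
  have \<gamma>_W0: "\<gamma> t \<in> ?S" and \<gamma>_smooth: "smooth_at real_line ?WA \<gamma> t"
    and \<gamma>_vel: "velocity ?WA \<gamma> t = Z (\<gamma> t)" if "t \<in> J" for t
    using \<gamma> that by (auto simp: integral_curve_def)
  have \<gamma>_W: "\<gamma> t \<in> fst ?W" and \<gamma>_z: "snd ?W (\<gamma> t) = (z t, (p t, p\<^sub>i t))" and zD: "z t \<in> D"
    if "t \<in> J" for t
    using \<gamma>_coords[OF that] by (auto simp: z_def)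
  have zero: "\<Psi> \<alpha> (z t) = 0" if "t \<in> J" for \<alpha> t
  proof -
    have "fst (\<gamma> t) \<in> M" "fst (\<gamma> t) \<in> fst (CJ_chart E \<pi> C \<pi>C \<kappa> \<mu>)"
      "snd (CJ_chart E \<pi> C \<pi>C \<kappa> \<mu>) (fst (\<gamma> t)) = z t"
      using \<gamma>_W0[OF that] \<gamma>_W[OF that] \<gamma>_z[OF that] by (auto simp: W0_def WM_def W_chart_def)
    then show ?thesis using M_eq[of "fst (\<gamma> t)"] zD[OF that] by simp
  qed
  have d\<Psi>: "(\<Psi> \<alpha> has_derivative frechet_derivative (\<Psi> \<alpha>) (at (z t))) (at (z t))" if "t \<in> J" for \<alpha> t
    by (rule smooth_on_has_derivative[OF \<Psi>_smooth zD[OF that]])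
  have d\<L>: "(\<L> has_derivative frechet_derivative \<L> (at (fst (z t)))) (at (fst (z t)))" if "t \<in> J" for t
    by (rule smooth_on_has_derivative[OF \<L>_smooth]) (use zD[OF that] in blast)
  \<comment> \<open>All that holds at a single time, with the derivative \<open>R\<close> of the
    momenta and the multipliers \<open>c\<close> as witnesses. The pairing argument is pointwise;
    choosing witnesses for every \<open>t\<close> afterwards makes them functions of time.\<close>
  define eqs where "eqs t R c \<longleftrightarrow>
      (q has_vector_derivative v t) (at t) \<and> (p\<^sub>i has_vector_derivative R) (at t) \<and>
      (\<forall>i. - p\<^sub>i t $ i = (\<Sum>\<alpha>\<in>UNIV. c \<alpha> * partial (\<Psi> \<alpha>) (((0, 0), 0), axis i 1) (z t))) \<and>
      (\<forall>i. partial \<L> ((0, axis i 1), 0) (fst (z t)) - R $ i =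
        (\<Sum>\<alpha>\<in>UNIV. c \<alpha> * partial (\<Psi> \<alpha>) (((0, axis i 1), 0), 0) (z t))) \<and>
      (\<forall>a. partial \<L> ((0, 0), axis a 1) (fst (z t)) =
        (\<Sum>\<alpha>\<in>UNIV. c \<alpha> * partial (\<Psi> \<alpha>) (((0, 0), axis a 1), 0) (z t)))"
    for t and R :: "real ^ 'n" and c :: "'s \<Rightarrow> real"
  have pointwise: "\<exists>R c. eqs t R c" if t: "t \<in> J" for t
  proof -
    \<comment> \<open>The curve itself supplies the point of \<open>M\<close> from which smoothness
      of the atlases is read off.\<close>
    have "fst (\<gamma> t) \<in> M" using \<gamma>_W0[OF t] by (auto simp: W0_def WM_def)
    then have W: "smooth_atlas ?WA"
      using smooth_atlas_W_atlas[OF E submanifold_smooth_atlas[OF sub]] by blast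
    obtain \<tau> Q U V P R where a: "velocity ?WA \<gamma> t ?W = ((((\<tau>, Q), U), V), (P, R))"
      by (metis surj_pair)
    have "((\<lambda>s. snd ?W (\<gamma> s)) has_vector_derivative ((((\<tau>, Q), U), V), (P, R))) (at t)"
      using smooth_at_real_line_differentiable[OF W \<gamma>_smooth[OF t] WA \<gamma>_W[OF t]] by (simp add: a)
    then have vd: "((\<lambda>s. (z s, (p s, p\<^sub>i s))) has_vector_derivative ((((\<tau>, Q), U), V), (P, R))) (at t)"
      by (rule has_vector_derivative_transform_within_open[OF _ J(1) t]) (simp add: \<gamma>_z)
    note comp = has_vector_derivative_compose[OF vd bounded_linear_imp_has_derivative]
    have "((\<lambda>s. fst (fst (fst (fst (z s, (p s, p\<^sub>i s)))))) has_vector_derivative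
        fst (fst (fst (fst ((((\<tau>, Q), U), V), (P, R)))))) (at t)"
      by (rule comp) (intro bounded_linear_fst_comp bounded_linear_fst)
    \<comment> \<open>The first coordinate of the curve is its parameter, so the derivative
      \<open>\<tau>\<close> of that coordinate is 1.\<close>
    then have "((\<lambda>s. s) has_vector_derivative \<tau>) (at t)" by (simp add: z_def)
    from vector_derivative_unique_at[OF this has_vector_derivative_id] have \<tau>: "\<tau> = 1" .
    have "((\<lambda>s. snd (fst (fst (fst (z s, (p s, p\<^sub>i s)))))) has_vector_derivative
        snd (fst (fst (fst ((((\<tau>, Q), U), V), (P, R)))))) (at t)"
      by (rule comp) (intro bounded_linear_fst_comp bounded_linear_snd_comp bounded_linear_fst)
    then have dq: "(q has_vector_derivative Q) (at t)" by (simp add: z_def)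
    have "((\<lambda>s. snd (snd (z s, (p s, p\<^sub>i s)))) has_vector_derivative
        snd (snd ((((\<tau>, Q), U), V), (P, R)))) (at t)"
      by (rule comp) (intro bounded_linear_snd_comp bounded_linear_snd)
    then have dp: "(p\<^sub>i has_vector_derivative R) (at t)" by simp
    let ?\<omega> = "\<lambda>\<alpha>. frechet_derivative (\<Psi> \<alpha>) (at (z t))" and ?l = "frechet_derivative \<L> (at (fst (z t)))"
    have lin\<omega>: "linear (?\<omega> \<alpha>)" for \<alpha> using d\<Psi>[OF t] by (rule has_derivative_linear)
    have linl: "linear ?l" using d\<L>[OF t] by (rule has_derivative_linear)
    \<comment> \<open>The left side expands to \<open>(Q - v t) \<bullet> r'\<close> plus the value
      at \<open>h\<close> of the covector \<open>\<theta>\<close> defined below. So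
      \<open>h = 0\<close> isolates the first term and \<open>r' = 0\<close> the second.\<close>
    have key: "canonical_form ((1, Q), (P, R))
        (fst (fst h), (?l (fst h) - r' \<bullet> v t - p\<^sub>i t \<bullet> snd h, r')) = 0"
      if h: "\<And>\<alpha>. ?\<omega> \<alpha> h = 0" for h r'
    proof -
      obtain c I where c: "open I" "0 \<in> I" "c 0 = \<gamma> t" "\<And>s. s \<in> I \<Longrightarrow> smooth_at real_line ?WA c s"
        "\<And>s. s \<in> I \<Longrightarrow> c s \<in> ?S" and vel: "velocity ?WA c 0 ?W =
          (h, (?l (fst h) - r' \<bullet> snd (z t) - p\<^sub>i t \<bullet> snd h, r'))"
        by (rule W0_curve[where r'=r', OF E sub chart \<Psi>_smooth M_eq \<Psi>_indep \<L>_smooth L_eq \<gamma>_W0[OF t] \<gamma>_W[OF t]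
              \<gamma>_z[OF t] zD[OF t] h]) (assumption+, rule that)
      let ?Y = "velocity ?WA c 0"
      have "?Y \<in> sub_tangent_space ?WA ?S (\<gamma> t)"
        unfolding sub_tangent_space_def using c by blast
      moreover have cW: "c 0 \<in> fst ?W" using c(3) \<gamma>_W[OF t] by simp
      note TY = tangent_map_to_cotangent_bundle[OF chart(1,2) W c(4)[OF c(2)] cW]
      note TZ = tangent_map_to_cotangent_bundle[OF chart(1,2) W \<gamma>_smooth[OF t] \<gamma>_W[OF t]]
      ultimately have "canonical_form
          (tangent_map ?WA (T_atlas E \<pi>) snd (\<gamma> t) (Z (\<gamma> t)) (T_chart E \<kappa>))
          (tangent_map ?WA (T_atlas E \<pi>) snd (\<gamma> t) ?Y (T_chart E \<kappa>)) = 0"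
        using Z_\<Omega> \<gamma>_W0[OF t] TZ(1) unfolding contraction_vanishes_def by blast
      then show ?thesis
        using TZ(2) TY(2) by (simp add: \<gamma>_vel[OF t, symmetric] a \<tau> c(3) vel) (simp add: z_def)
    qed
    have Q: "Q = v t"
    proof -
      have "(Q - v t) \<bullet> r' = 0" for r'
        using key[of 0 r'] linear_0[OF lin\<omega>] linear_0[OF linl]
        by (simp add: canonical_form_def inner_vec_def sum_subtractf algebra_simps zero_prod_def)
      from this[of "Q - v t"] show ?thesis by simp
    qed
    define \<theta> where "\<theta> h = ?l (fst h) - p\<^sub>i t \<bullet> snd h - R \<bullet> snd (fst (fst h)) - P * fst (fst (fst h))"
      for h :: "('n, 'm) CJ_coords"
    have "linear \<theta>"
      by (rule linearI)
        (simp_all add: \<theta>_def linear_add[OF linl] linear_cmul[OF linl] inner_add_right algebra_simps)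
    moreover have "\<theta> h = 0" if "\<And>\<alpha>. ?\<omega> \<alpha> h = 0" for h
      using key[OF that, of 0]
      by (simp add: \<theta>_def canonical_form_def inner_vec_def sum_negf case_prod_beta mult.commute)
    moreover have "wedge ?\<omega> \<noteq> (\<lambda>_. 0)" using \<Psi>_indep[OF zD[OF t]] zero[OF t] by blast
    ultimately obtain c where c: "\<And>h. \<theta> h = (\<Sum>\<alpha>\<in>UNIV. c \<alpha> * ?\<omega> \<alpha> h)"
      using covector_in_span[of ?\<omega> \<theta>] lin\<omega> by blast
    have par\<Psi>: "partial (\<Psi> \<alpha>) h (z t) = ?\<omega> \<alpha> h" for \<alpha> h
      using d\<Psi>[OF t] by (intro partial_eq_frechet_derivative) (auto simp: differentiable_def)
    have par\<L>: "partial \<L> h (fst (z t)) = ?l h" for h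
      using d\<L>[OF t] by (intro partial_eq_frechet_derivative) (auto simp: differentiable_def)
    \<comment> \<open>Evaluated on coordinate vectors, the representation of \<open>\<theta>\<close>
      splits: the \<open>v\<close> directions give the momenta, the \<open>q\<close> directions
      their derivatives, the \<open>u\<close> directions stationarity in the controls.\<close>
    have "\<theta> (((0, 0), 0), axis i 1) = - p\<^sub>i t $ i" for i
      using linear_0[OF linl] by (simp add: \<theta>_def inner_axis zero_prod_def)
    moreover have "\<theta> (((0, axis i 1), 0), 0) = ?l ((0, axis i 1), 0) - R $ i" for i
      by (simp add: \<theta>_def inner_axis)
    moreover have "\<theta> (((0, 0), axis b 1), 0) = ?l ((0, 0), axis b 1)" for b
      by (simp add: \<theta>_def)
    ultimately show ?thesis
      using dq dp c unfolding eqs_def Q par\<Psi> par\<L> by (intro exI[of _ R] exI[of _ c]) metis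
  qed
  then obtain R c where eqs: "\<And>t. t \<in> J \<Longrightarrow> eqs t (R t) (c t)" by metis
  have dq: "(q has_vector_derivative v t) (at t)"
    and dp: "(p\<^sub>i has_vector_derivative R t) (at t)"
    and eq_v: "- p\<^sub>i t $ i = (\<Sum>\<alpha>\<in>UNIV. c t \<alpha> * partial (\<Psi> \<alpha>) (((0, 0), 0), axis i 1) (z t))"
    and eq_q: "partial \<L> ((0, axis i 1), 0) (fst (z t)) - R t $ i =
      (\<Sum>\<alpha>\<in>UNIV. c t \<alpha> * partial (\<Psi> \<alpha>) (((0, axis i 1), 0), 0) (z t))"
    and eq_u: "partial \<L> ((0, 0), axis a 1) (fst (z t)) =
      (\<Sum>\<alpha>\<in>UNIV. c t \<alpha> * partial (\<Psi> \<alpha>) (((0, 0), axis a 1), 0) (z t))"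
    if "t \<in> J" for t i a
    using eqs[OF that] unfolding eqs_def by blast+
  have z_eq: "(((t, q t), u t), vector_derivative q (at t)) = z t" if "t \<in> J" for t
    using vector_derivative_at[OF dq[OF that]] by (simp add: z_def)
  have d: "((\<lambda>\<tau>. \<Sum>\<alpha>\<in>UNIV. c \<tau> \<alpha> * partial (\<Psi> \<alpha>) (((0, 0), 0), axis i 1)
      (((\<tau>, q \<tau>), u \<tau>), vector_derivative q (at \<tau>))) has_real_derivative - R t $ i) (at t)"
    if t: "t \<in> J" for t i
  proof -
    have "((\<lambda>\<tau>. - p\<^sub>i \<tau> $ i) has_vector_derivative - R t $ i) (at t)"
      by (rule has_vector_derivative_compose[OF dp[OF t]])
        (auto intro!: bounded_linear_imp_has_derivative bounded_linear_minus bounded_linear_vec_nth)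
    \<comment> \<open>The sum equals \<open>- p\<^sub>i \<tau> $ i\<close> on the whole open set
      \<open>J\<close>, so the derivative carries over and no product rule is applied to the
      multipliers.\<close>
    then show ?thesis
      unfolding has_real_derivative_iff_has_vector_derivative
      by (rule has_vector_derivative_transform_within_open[OF _ J(1) t]) (simp add: z_eq eq_v)
  qed
  show ?thesis
  proof (intro conjI ballI exI[of _ "\<lambda>\<alpha> t. c t \<alpha>"] allI)
    fix t assume t: "t \<in> J"
    show "(q has_vector_derivative v t) (at t)" by (rule dq[OF t])
    show "\<Psi> \<alpha> (((t, q t), u t), vector_derivative q (at t)) = 0" for \<alpha>
      by (simp add: z_eq[OF t] zero[OF t])
    show "partial \<L> ((0, 0), axis a 1) ((t, q t), u t) - (\<Sum>\<alpha>\<in>UNIV. c t \<alpha> *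
        partial (\<Psi> \<alpha>) (((0, 0), axis a 1), 0) (((t, q t), u t), vector_derivative q (at t))) = 0" for a
      unfolding z_eq[OF t] using eq_u[OF t] by (simp add: z_def)
    show "(\<lambda>\<tau>. \<Sum>\<alpha>\<in>UNIV. c \<tau> \<alpha> * partial (\<Psi> \<alpha>) (((0, 0), 0), axis i 1)
        (((\<tau>, q \<tau>), u \<tau>), vector_derivative q (at \<tau>))) differentiable (at t)" for i
      using d[OF t] real_differentiable_def by blast
    show "deriv (\<lambda>\<tau>. \<Sum>\<alpha>\<in>UNIV. c \<tau> \<alpha> * partial (\<Psi> \<alpha>) (((0, 0), 0), axis i 1)
          (((\<tau>, q \<tau>), u \<tau>), vector_derivative q (at \<tau>))) t
        + partial \<L> ((0, axis i 1), 0) ((t, q t), u t)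
        - (\<Sum>\<alpha>\<in>UNIV. c t \<alpha> *
          partial (\<Psi> \<alpha>) (((0, axis i 1), 0), 0) (((t, q t), u t), vector_derivative q (at t))) = 0" for i
      \<comment> \<open>With the last sum rewritten by \<open>eq_q\<close> as the
        \<open>q\<close>-partial of \<open>\<L>\<close> minus \<open>R t $ i\<close>, it cancels
        against the derivative \<open>- R t $ i\<close> and the middle term.\<close>
      unfolding DERIV_imp_deriv[OF d[OF t]] z_eq[OF t] eq_q[OF t, symmetric] by (simp add: z_def)
  qed
qed

end
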